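(* Consider a nonlinear Markov decision problem with a state-partitioned tabular policy in softmax coordinates, with notation as in the context. Let $\boldsymbol\theta^*$ be a pure policy, and let $\{\boldsymbol\gamma_n\}$ be a sequence in $\boldsymbol\Gamma$ with $\boldsymbol\theta(\boldsymbol\gamma_n)\to\boldsymbol\theta^*$ as $n\to\infty$. Define $\mu^{(t)}_*=\lim_{n\to\infty}\mu^{(t)}_{\boldsymbol\gamma_n}$ and $R^{(t)}_\mu=\{(s,a,s'):\mu(s)>0,\ p^{(t)}_\mu(s'|s,a)>0\}$. Suppose that 1. the set $\mathcal U(\boldsymbol\gamma_n)$ is eventually independent of $n$, and the null space of $F(\boldsymbol\gamma_n)$ is a fixed subspace of dimension $T\times|\mathcal Z|+(|\mathcal A|-1)\times|\mathcal U(\boldsymbol\gamma_n)|$; 2. for all $t$, $\{s:\mu^{(t)}_{\boldsymbol\gamma_n}(s)>0\}$ eventually equals $\{s:\mu^{(t)}_*(s)>0\}$; and 3. for all $t$, $R^{(t)}_{\mu^{(t)}_{\boldsymbol\gamma_n}}$ eventually equals $R^{(t)}_{\mu^{(t)}_*}$. Then $$\lim_{n\to\infty}\left\|\widehat\nabla_{\boldsymbol\gamma}J_{\boldsymbol\gamma_n}-\widetilde\nabla_{\boldsymbol\gamma}J_{\boldsymbol\gamma_n}\right\|=0 .$$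
   Context: Smooth extension property: a function on a convex subset of Euclidean space has the smooth extension property if it admits an extension to a neighborhood of the relative interior of its domain that is continuously differentiable, with the gradient extending by continuity to all boundary points in the original domain. Gradients are taken in ordinary coordinates using such extensions. Nonlinear Markov decision problem: horizon $T$; finite state space $\mathcal S$ and action space $\mathcal A$; transition pmfs $p^{(t)}_\mu(\cdot|s,a)$ on $\mathcal S$ ($0\le t<T$), immediate rewards $r^{(t)}_\mu(s,a)$ ($0\le t<T$) and terminal reward $r^{(T)}_\mu(s)$, all parameterized by a pmf $\mu$ on $\mathcal S$ and such that their restrictions to $\{\mu:\mu(s)>0\}$ have the smooth extension property in $\mu$; and an initial pmf $\mu^{(0)}$ on $\mathcal S$. State-partitioned tabular policy: $\mathcal S$ is partitioned into disjoint subsets $\mathcal S_z$, $z\in\mathcal Z$ ($\mathcal Z$ finite; experts), and $z(s)$ is the $z$ with $s\in\mathcal S_z$. In the pmf representation the parameter is $\boldsymbol\theta=(\theta^{(t)}_z)_{0\le t<T,z\in\mathcal Z}$, each $\theta^{(t)}_z$ a pmf on $\mathcal A$, with policy $\pi^{(t)}(a|s)=\theta^{(t)}_{z(s)}(a)$. $\boldsymbol\theta$ is a pure policy if the support of every $\theta^{(t)}_z$ is a singleton. In softmax coordinates the parameter space $\boldsymbol\Gamma$ consists of all $\boldsymbol\gamma=(\gamma^{(t)}_z)_{t,z}$ with $\gamma^{(t)}_z=(\gamma^{(t)}_{z,a})_{a\in\mathcal A}\in\mathbb R^{|\mathcal A|}$ and $\sum_a\gamma^{(t)}_{z,a}=0$;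 with $\hat\pi_\psi(a)=\exp(\psi_a)/\sum_{\tilde a}\exp(\psi_{\tilde a})$, the corresponding $\boldsymbol\theta(\boldsymbol\gamma)$ is given by $\theta^{(t)}_z=\hat\pi_{\gamma^{(t)}_z}$. Gradients in $\boldsymbol\gamma$ are taken in ambient coordinates (each $\gamma^{(t)}_z$ ranging in $\mathbb R^{|\mathcal A|}$, via the softmax formula), so $F(\boldsymbol\gamma)$ below has $T\times|\mathcal Z|\times|\mathcal A|$ columns. Forward recursion: $\mu^{(0)}_{\boldsymbol\gamma}=\mu^{(0)}$, $\mu^{(t+1)}_{\boldsymbol\gamma}(s')=\sum_{s,a}\mu^{(t)}_{\boldsymbol\gamma}(s)\hat\pi_{\gamma^{(t)}_{z(s)}}(a)p^{(t)}_{\mu^{(t)}_{\boldsymbol\gamma}}(s'|s,a)$. Objective: $$J_{\boldsymbol\gamma}=\sum_{t=0}^{T-1}\sum_{s,a}\mu^{(t)}_{\boldsymbol\gamma}(s)\hat\pi_{\gamma^{(t)}_{z(s)}}(a)r^{(t)}_{\mu^{(t)}_{\boldsymbol\gamma}}(s,a)+\sum_s\mu^{(T)}_{\boldsymbol\gamma}(s)r^{(T)}_{\mu^{(T)}_{\boldsymbol\gamma}}(s).$$ Trajectory pmf: $q_{\boldsymbol\gamma}(s^{(0)},a^{(0)},\ldots,s^{(T)})=\mu^{(0)}(s^{(0)})\prod_{t=0}^{T-1}\hat\pi_{\gamma^{(t)}_{z(s^{(t)})}}(a^{(t)})\,p^{(t)}_{\mu^{(t)}_{\boldsymbol\gamma}}(s^{(t+1)}|s^{(t)},a^{(t)})$,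 with $\mathbb E_{\boldsymbol\gamma}$ the corresponding expectation. Set $\mu(\mathcal S_z)=\sum_{s\in\mathcal S_z}\mu(s)$ and $\mathcal U(\boldsymbol\gamma)=\{(t,z):\mu^{(t)}_{\boldsymbol\gamma}(\mathcal S_z)=0\}$ (with $0\le t<T$, $z\in\mathcal Z$). Fisher information matrix: $F(\boldsymbol\gamma)=\mathbb E_{\boldsymbol\gamma}\big[\nabla_{\boldsymbol\gamma}\log q_{\boldsymbol\gamma}\,(\nabla_{\boldsymbol\gamma}\log q_{\boldsymbol\gamma})^\top\big]$, evaluated at the random trajectory. Natural gradient: $\widehat\nabla_{\boldsymbol\gamma}J_{\boldsymbol\gamma}=F(\boldsymbol\gamma)^\dagger\nabla_{\boldsymbol\gamma}J_{\boldsymbol\gamma}$, with $\dagger$ the Moore-Penrose inverse. Approximate natural gradient: $\widetilde\nabla_{\boldsymbol\gamma}J_{\boldsymbol\gamma}=\tilde F(\boldsymbol\gamma)^\dagger\nabla_{\boldsymbol\gamma}J_{\boldsymbol\gamma}$, where $\tilde F(\boldsymbol\gamma)$ is block diagonal with diagonal block for $(t,z)$ equal to $\mu^{(t)}_{\boldsymbol\gamma}(\mathcal S_z)\,\hat F(\gamma^{(t)}_z)$ and $\hat F(\psi)=\sum_a\hat\pi_\psi(a)(\nabla_\psi\log\hat\pi_\psi(a))(\nabla_\psi\log\hat\pi_\psi(a))^\top$. "Eventually" means for all sufficiently large $n$.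
   Formalization: The gradient of J at γ is taken with the sums over s restricted to states of positive mass at γ; this is ∇J if rewards of massless states stay bounded near γ or supports are locally constant; otherwise J may have no gradient (e.g. reward 1/μ(s)² at a state massless only at γ_n). *)

theory Defs
  imports "HOL-Analysis.Analysis"
begin

section \<open>Euclidean preliminaries\<close>

text \<open>Pmfs on a finite type are vectors in the standard simplex, so that smoothness in a pmf
  makes sense.\<close>

definition pmfs :: "(real ^ 'i::finite) set" where
  "pmfs = {x. (\<forall>i. 0 \<le> x $ i) \<and> (\<Sum>i\<in>UNIV. x $ i) = 1}"

text \<open>The extension lives on \<open>U \<union> D\<close>: differentiable on a neighbourhood \<open>U\<close> of the relative
  interior, with a gradient field \<open>G\<close> that is continuous up to the boundary points lying in \<open>D\<close>.
  Continuity of the extension itself at those boundary points has to be demanded separately;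
  otherwise the values of \<open>f\<close> there would be unrelated to \<open>G\<close>.\<close>

definition smooth_extension :: "(real ^ 'i::finite) set \<Rightarrow> (real ^ 'i \<Rightarrow> real) \<Rightarrow> bool" where
  "smooth_extension D f \<longleftrightarrow>
     (\<exists>U g G. open U \<and> rel_interior D \<subseteq> U \<and>
        (\<forall>x\<in>D. g x = f x) \<and> continuous_on (U \<union> D) g \<and>
        (\<forall>x\<in>U. GDERIV g x :> G x) \<and> continuous_on (U \<union> D) G)"

text \<open>Unspecified where \<open>f\<close> is not differentiable.\<close>

definition gradient :: "('v::real_inner \<Rightarrow> real) \<Rightarrow> 'v \<Rightarrow> 'v" where
  "gradient f x = (THE D. GDERIV f x :> D)"

definition outer :: "real ^ 'i \<Rightarrow> real ^ 'i \<Rightarrow> real ^ 'i ^ 'i" where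
  "outer v w = (\<chi> i j. v $ i * w $ j)"

definition pinv :: "real ^ 'n::finite ^ 'm::finite \<Rightarrow> real ^ 'm ^ 'n" where
  "pinv A = (THE X. A ** X ** A = A \<and> X ** A ** X = X \<and>
                    transpose (A ** X) = A ** X \<and> transpose (X ** A) = X ** A)"

definition softmax :: "real ^ 'a::finite \<Rightarrow> real ^ 'a" where
  "softmax \<psi> = (\<chi> a. exp (\<psi> $ a) / (\<Sum>b\<in>UNIV. exp (\<psi> $ b)))"


section \<open>Nonlinear Markov decision problems\<close>

text \<open>\<open>transition M t \<mu> s a $ s'\<close> is $p^{(t)}_\mu(s'|s,a)$.\<close>

record ('s, 'a) nmdp =
  horizon :: nat
  transition :: "nat \<Rightarrow> real ^ 's \<Rightarrow> 's \<Rightarrow> 'a \<Rightarrow> real ^ 's"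
  reward :: "nat \<Rightarrow> real ^ 's \<Rightarrow> 's \<Rightarrow> 'a \<Rightarrow> real"
  final_reward :: "real ^ 's \<Rightarrow> 's \<Rightarrow> real"
  init_pmf :: "real ^ 's"

definition nonlinear_mdp :: "('s::finite, 'a::finite) nmdp \<Rightarrow> bool" where
  "nonlinear_mdp M \<longleftrightarrow>
     init_pmf M \<in> pmfs \<and>
     (\<forall>t<horizon M. \<forall>\<mu>\<in>pmfs. \<forall>s a. transition M t \<mu> s a \<in> pmfs) \<and>
     (\<forall>t<horizon M. \<forall>s a s'.
        smooth_extension {\<mu> \<in> pmfs. \<mu> $ s > 0} (\<lambda>\<mu>. transition M t \<mu> s a $ s')) \<and>
     (\<forall>t<horizon M. \<forall>s a.
        smooth_extension {\<mu> \<in> pmfs. \<mu> $ s > 0} (\<lambda>\<mu>. reward M t \<mu> s a)) \<and>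
     (\<forall>s. smooth_extension {\<mu> \<in> pmfs. \<mu> $ s > 0} (\<lambda>\<mu>. final_reward M \<mu> s))"

definition successors :: "('s::finite, 'a) nmdp \<Rightarrow> nat \<Rightarrow> real ^ 's \<Rightarrow> ('s \<times> 'a \<times> 's) set" where
  "successors M t \<mu> = {(s, a, s'). \<mu> $ s > 0 \<and> transition M t \<mu> s a $ s' > 0}"


section \<open>State-partitioned tabular policies\<close>

text \<open>The partition of the states is given by the map \<open>\<zeta> :: 's \<Rightarrow> 'z\<close> sending a state to its
  expert; the block of \<open>z\<close> is \<open>{s. \<zeta> s = z}\<close>.

  The coordinates of a parameter are indexed by \<open>'t \<times> 'z \<times> 'a\<close>, where \<open>'t\<close> has as many elements
  as the horizon. The type \<open>'t\<close> only labels the times \<open>0, \<dots>, CARD('t) - 1\<close>, through the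
  bijection \<open>from_nat_into UNIV\<close> whose inverse is \<open>to_nat_on UNIV\<close>.\<close>

type_synonym ('t, 'z, 'a) param = "real ^ ('t \<times> 'z \<times> 'a)"

definition pure_policy :: "nat \<Rightarrow> (nat \<Rightarrow> 'z \<Rightarrow> real ^ 'a::finite) \<Rightarrow> bool" where
  "pure_policy T \<theta> \<longleftrightarrow>
     (\<forall>t<T. \<forall>z. \<theta> t z \<in> pmfs \<and> is_singleton {a. \<theta> t z $ a > 0})"

definition centered_params :: "('t::finite, 'z::finite, 'a::finite) param set" where
  "centered_params = {\<gamma>. \<forall>i z. (\<Sum>a\<in>UNIV. \<gamma> $ (i, z, a)) = 0}"

definition block ::
    "('t::finite, 'z::finite, 'a::finite) param \<Rightarrow> nat \<Rightarrow> 'z \<Rightarrow> real ^ 'a" where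
  "block \<gamma> t z = (\<chi> a. \<gamma> $ (from_nat_into UNIV t, z, a))"

definition policy ::
    "('t::finite, 'z::finite, 'a::finite) param \<Rightarrow> nat \<Rightarrow> 'z \<Rightarrow> real ^ 'a" where
  "policy \<gamma> t z = softmax (block \<gamma> t z)"

fun state_pmf :: "('s::finite, 'a::finite) nmdp \<Rightarrow> ('s \<Rightarrow> 'z::finite)
    \<Rightarrow> ('t::finite, 'z, 'a) param \<Rightarrow> nat \<Rightarrow> real ^ 's" where
  "state_pmf M \<zeta> \<gamma> 0 = init_pmf M"
| "state_pmf M \<zeta> \<gamma> (Suc t) =
     (\<chi> s'. \<Sum>s\<in>UNIV. \<Sum>a\<in>UNIV. state_pmf M \<zeta> \<gamma> t $ s * policy \<gamma> t (\<zeta> s) $ a *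
        transition M t (state_pmf M \<zeta> \<gamma> t) s a $ s')"

definition block_mass :: "('s::finite \<Rightarrow> 'z) \<Rightarrow> real ^ 's \<Rightarrow> 'z \<Rightarrow> real" where
  "block_mass \<zeta> \<mu> z = (\<Sum>s | \<zeta> s = z. \<mu> $ s)"

definition unvisited :: "('s::finite, 'a::finite) nmdp \<Rightarrow> ('s \<Rightarrow> 'z::finite)
    \<Rightarrow> ('t::finite, 'z, 'a) param \<Rightarrow> (nat \<times> 'z) set" where
  "unvisited M \<zeta> \<gamma> = {(t, z). t < horizon M \<and> block_mass \<zeta> (state_pmf M \<zeta> \<gamma> t) z = 0}"


section \<open>Objective and its gradient\<close>

text \<open>In \<open>objective_over\<close> the states at time \<open>t\<close> are summed over \<open>A t\<close> only.\<close>

definition objective_over :: "(nat \<Rightarrow> 's set) \<Rightarrow> ('s::finite, 'a::finite) nmdp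
    \<Rightarrow> ('s \<Rightarrow> 'z::finite) \<Rightarrow> ('t::finite, 'z, 'a) param \<Rightarrow> real" where
  "objective_over A M \<zeta> \<gamma> =
     (\<Sum>t<horizon M. \<Sum>s\<in>A t. \<Sum>a\<in>UNIV.
        state_pmf M \<zeta> \<gamma> t $ s * policy \<gamma> t (\<zeta> s) $ a *
        reward M t (state_pmf M \<zeta> \<gamma> t) s a) +
     (\<Sum>s\<in>A (horizon M).
        state_pmf M \<zeta> \<gamma> (horizon M) $ s *
        final_reward M (state_pmf M \<zeta> \<gamma> (horizon M)) s)"

definition objective :: "('s::finite, 'a::finite) nmdp
    \<Rightarrow> ('s \<Rightarrow> 'z::finite) \<Rightarrow> ('t::finite, 'z, 'a) param \<Rightarrow> real" where
  "objective = objective_over (\<lambda>_. UNIV)"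

definition visited :: "('s::finite, 'a::finite) nmdp \<Rightarrow> ('s \<Rightarrow> 'z::finite)
    \<Rightarrow> ('t::finite, 'z, 'a) param \<Rightarrow> nat \<Rightarrow> 's set" where
  "visited M \<zeta> \<gamma> t = {s. state_pmf M \<zeta> \<gamma> t $ s > 0}"

text \<open>The reward at \<open>s\<close> has an (extended) gradient in \<open>\<mu>\<close> only where \<open>\<mu> $ s > 0\<close>, so the states
  of mass zero at \<open>\<gamma>\<close> do not contribute to the gradient of the objective at \<open>\<gamma>\<close>. Leaving them out
  does not change the value at \<open>\<gamma>\<close>, and the result is the gradient of \<open>objective\<close> unless such a
  state acquires mass arbitrarily close to \<open>\<gamma>\<close> while its reward is unbounded there
  (\<open>objective_gradient_eq\<close> below). In that remaining case smoothness on \<open>{\<mu>. \<mu> $ s > 0}\<close> says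
  nothing about the reward near \<open>\<gamma>\<close>, and \<open>objective\<close> may even be discontinuous at \<open>\<gamma>\<close>.\<close>

definition objective_gradient :: "('s::finite, 'a::finite) nmdp \<Rightarrow> ('s \<Rightarrow> 'z::finite)
    \<Rightarrow> ('t::finite, 'z, 'a) param \<Rightarrow> ('t, 'z, 'a) param" where
  "objective_gradient M \<zeta> \<gamma> = gradient (objective_over (visited M \<zeta> \<gamma>) M \<zeta>) \<gamma>"


lemma smooth_extension_differentiable:
  fixes f :: "real ^ 'i::finite \<Rightarrow> real"
  assumes "smooth_extension D f" "convex D" "x \<in> D"
  shows "f differentiable (at x within D)"
proof -
  obtain U g G where U: "open U" "rel_interior D \<subseteq> U" and gf: "\<And>x. x \<in> D \<Longrightarrow> g x = f x"
    and cg: "continuous_on (U \<union> D) g" and Gd: "\<And>x. x \<in> U \<Longrightarrow> GDERIV g x :> G x"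
    and cG: "continuous_on (U \<union> D) G"
    using assms(1) unfolding smooth_extension_def by metis
  obtain c where c: "c \<in> rel_interior D"
    using rel_interior_eq_empty[OF assms(2)] assms(3) by blast
  have "(g has_derivative (\<lambda>h. inner h (G x))) (at x within D)"
    unfolding has_derivative_within_alt
  proof (intro conjI allI impI)
    show "bounded_linear (\<lambda>h. inner h (G x))" by (rule bounded_linear_inner_left)
    fix e :: real assume e: "e > 0"
    obtain d where d: "d > 0" "\<And>y. y \<in> U \<union> D \<Longrightarrow> dist y x < d \<Longrightarrow> dist (G y) (G x) < e"
      using cG assms(3) e unfolding continuous_on_iff by blast
    let ?V = "rel_interior D \<inter> ball x d"
    let ?k = "\<lambda>u. g u - inner u (G x)"
    have convV: "convex ?V" using assms(2) by (simp add: convex_rel_interior convex_Int)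
    have bnd: "norm (?k u - ?k v) \<le> e * norm (u - v)" if "u \<in> ?V" "v \<in> ?V" for u v
    proof (rule differentiable_bound[where f = ?k and f' = "\<lambda>y h. inner h (G y) - inner h (G x)", OF convV _ _ that])
      fix y assume y: "y \<in> ?V"
      have "(g has_derivative (\<lambda>h. inner h (G y))) (at y within ?V)"
        using Gd[of y] y U(2) unfolding gderiv_def by (blast intro: has_derivative_at_withinI)
      then show "(?k has_derivative (\<lambda>h. inner h (G y) - inner h (G x))) (at y within ?V)"
        by (intro has_derivative_diff bounded_linear_imp_has_derivative bounded_linear_inner_left)
      have e': "norm (G y - G x) \<le> e"
        using d(2)[of y] y U(2) by (auto simp: dist_norm norm_minus_commute less_imp_le)
      show "onorm (\<lambda>h. inner h (G y) - inner h (G x)) \<le> e"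
      proof (rule onorm_le)
        fix h
        have "norm (inner h (G y) - inner h (G x)) \<le> norm h * norm (G y - G x)"
          by (simp add: Cauchy_Schwarz_ineq2 flip: inner_diff_right)
        also have "\<dots> \<le> norm h * e" by (intro mult_left_mono e') simp
        finally show "norm (inner h (G y) - inner h (G x)) \<le> e * norm h" by (simp add: mult.commute)
      qed
    qed
    have "norm (?k y - ?k x) \<le> e * norm (y - x)" if y: "y \<in> D" "norm (y - x) < d" for y
    proof (rule tendsto_le[of "at_right (0::real)"])
      let ?p = "\<lambda>w l. w - l *\<^sub>R (w - c)"
      have ev: "eventually (\<lambda>l::real. 0 < l \<and> l \<le> 1) (at_right 0)"
        using eventually_at_right_real[of 0 1] by (auto elim: eventually_mono)
      have inD: "?p w l \<in> rel_interior D" if "w \<in> D" "0 < l" "l \<le> 1" for w l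
        using rel_interior_convex_shrink[OF assms(2) c that] .
      have lim: "((\<lambda>l. ?p w l) \<longlongrightarrow> w) (at_right 0)" for w
      proof -
        have "((\<lambda>l. ?p w l) \<longlongrightarrow> w - 0 *\<^sub>R (w - c)) (at_right 0)" by (intro tendsto_intros)
        then show ?thesis by simp
      qed
      have limk: "((\<lambda>l. ?k (?p w l)) \<longlongrightarrow> ?k w) (at_right 0)" if w: "w \<in> D" for w
      proof -
        have "((\<lambda>l. g (?p w l)) \<longlongrightarrow> g w) (at_right 0)"
          by (rule continuous_on_tendsto_compose[OF cg lim])
            (use w in \<open>auto intro!: eventually_mono[OF ev] dest: inD[OF w] rel_interior_subset[THEN subsetD]\<close>)
        then show ?thesis by (intro tendsto_intros lim)
      qed
      show "((\<lambda>l. norm (?k (?p y l) - ?k (?p x l))) \<longlongrightarrow> norm (?k y - ?k x)) (at_right 0)"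
        by (intro tendsto_norm tendsto_diff limk y assms)
      show "((\<lambda>l. e * norm (?p y l - ?p x l)) \<longlongrightarrow> e * norm (y - x)) (at_right 0)"
        by (intro tendsto_intros tendsto_norm tendsto_diff lim)
      have near: "eventually (\<lambda>l. ?p w l \<in> ball x d) (at_right 0)" if "norm (w - x) < d" for w
        by (rule topological_tendstoD[OF lim]) (use that in \<open>auto simp: dist_norm norm_minus_commute\<close>)
      have near_x: "eventually (\<lambda>l. ?p x l \<in> ball x d) (at_right 0)"
        using d(1) by (intro near) simp
      show "\<forall>\<^sub>F l in at_right 0. norm (?k (?p y l) - ?k (?p x l)) \<le> e * norm (?p y l - ?p x l)"
        using ev near[OF y(2)] near_x
      proof eventually_elim
        case (elim l)
        then show ?case using d(1) by (intro bnd) (auto intro!: inD y assms)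
      qed
    qed simp
    then show "\<exists>d>0. \<forall>y\<in>D. norm (y - x) < d \<longrightarrow>
        norm (g y - g x - inner (y - x) (G x)) \<le> e * norm (y - x)"
      using d(1) by (intro exI[of _ d]) (auto simp: inner_diff_left algebra_simps)
  qed
  then have "(f has_derivative (\<lambda>h. inner h (G x))) (at x within D)"
    by (rule has_derivative_transform[OF assms(3) gf[symmetric], rotated -1]) 
  then show ?thesis unfolding differentiable_def by blast
qed

lemma has_derivative_sum_zero:
  "(\<And>i. i \<in> I \<Longrightarrow> (h i has_derivative (\<lambda>_. 0)) F) \<Longrightarrow>
    ((\<lambda>x. \<Sum>i\<in>I. h i x) has_derivative (\<lambda>_. 0)) F"
  using has_derivative_sum[of I h "\<lambda>_ _. 0" F] by simp

lemma has_derivative_mult_vanishing: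
  fixes f g :: "'v::euclidean_space \<Rightarrow> real"
  assumes "f differentiable (at x)" "f x = 0" "\<And>y. f y \<ge> 0"
    and "eventually (\<lambda>y. f y = 0 \<or> \<bar>g y\<bar> \<le> B) (nhds x)"
  shows "((\<lambda>y. f y * g y) has_derivative (\<lambda>_. 0)) (at x)"
proof -
  obtain f' where "(f has_derivative f') (at x)" using assms(1) unfolding differentiable_def by blast
  moreover from this have "f' = (\<lambda>_. 0)"
    by (rule differential_zero_maxmin[of x UNIV, rotated 2]) (use assms in auto)
  ultimately have f: "(f has_derivative (\<lambda>_. 0)) (at x)" by simp
  have "((\<lambda>y. norm (f y - f x - 0) / norm (y - x)) \<longlongrightarrow> 0) (at x)"
    using f unfolding has_derivative_iff_norm by blast
  then have "((\<lambda>y. \<bar>B\<bar> * (norm (f y - f x - 0) / norm (y - x))) \<longlongrightarrow> \<bar>B\<bar> * 0) (at x)"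
    by (intro tendsto_intros)
  then have "((\<lambda>y. \<bar>B\<bar> * (\<bar>f y\<bar> / norm (y - x))) \<longlongrightarrow> 0) (at x)"
    using assms(2) by simp
  moreover have "eventually (\<lambda>y. norm (norm (f y * g y - f x * g x - 0) / norm (y - x))
      \<le> \<bar>B\<bar> * (\<bar>f y\<bar> / norm (y - x))) (at x)"
    using assms(4) unfolding eventually_nhds_conv_at
  proof (elim conjE eventually_mono)
    fix y assume "f y = 0 \<or> \<bar>g y\<bar> \<le> B"
    then have "\<bar>f y\<bar> * \<bar>g y\<bar> \<le> \<bar>f y\<bar> * \<bar>B\<bar>" by (elim disjE) (auto intro!: mult_left_mono)
    then have "\<bar>f y\<bar> * \<bar>g y\<bar> / norm (y - x) \<le> \<bar>f y\<bar> * \<bar>B\<bar> / norm (y - x)"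
      by (rule divide_right_mono) simp
    then show "norm (norm (f y * g y - f x * g x - 0) / norm (y - x))
      \<le> \<bar>B\<bar> * (\<bar>f y\<bar> / norm (y - x))"
      using assms(2) by (simp add: abs_mult mult.commute)
  qed
  ultimately have "((\<lambda>y. norm (f y * g y - f x * g x - 0) / norm (y - x)) \<longlongrightarrow> 0) (at x)"
    by (rule Lim_null_comparison[rotated])
  then show ?thesis unfolding has_derivative_iff_norm by simp
qed

lemma convex_positive_pmfs: "convex {\<mu> \<in> pmfs. \<mu> $ s > 0}"
  unfolding convex_def pmfs_def
  apply (auto simp: sum.distrib simp flip: sum_distrib_left)
  by (smt (verit, ccfv_SIG) mult_nonneg_nonneg mult_pos_pos)

lemma softmax_pmfs: "softmax \<psi> \<in> pmfs"
proof -
  have "(\<Sum>b\<in>UNIV. exp (\<psi> $ b)) > 0" by (intro sum_pos) auto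
  then show ?thesis unfolding pmfs_def softmax_def
    by (auto simp flip: sum_divide_distrib intro!: divide_nonneg_nonneg sum_nonneg)
qed

lemma pmfs_le_1: assumes "x \<in> pmfs" shows "x $ i \<le> 1"
proof -
  have "x $ i \<le> (\<Sum>i\<in>UNIV. x $ i)"
    using assms by (intro member_le_sum) (auto simp: pmfs_def)
  then show ?thesis using assms by (simp add: pmfs_def)
qed

lemma pmfs_ge_0: "x \<in> pmfs \<Longrightarrow> 0 \<le> x $ i"
  by (simp add: pmfs_def)

lemma policy_differentiable:
  fixes \<gamma> :: "('t::finite, 'z::finite, 'a::finite) param"
  shows "(\<lambda>\<gamma>. policy \<gamma> t z $ a) differentiable (at \<gamma>)"
proof -
  have "(\<Sum>b\<in>UNIV. exp (\<gamma> $ (from_nat_into UNIV t, z, b))) \<noteq> 0"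
    by (rule less_imp_neq[symmetric], intro sum_pos) auto
  moreover have "(\<lambda>\<gamma>. exp (\<gamma> $ k)) differentiable (at \<gamma>)" for k :: "'t \<times> 'z \<times> 'a"
    unfolding differentiable_def
    by (rule exI, (rule derivative_eq_intros bounded_linear.has_derivative[OF bounded_linear_vec_nth] refl)+)
  ultimately show ?thesis
    unfolding policy_def softmax_def block_def
    by (auto intro!: differentiable_divide differentiable_sum)
qed

lemma state_pmf_pmfs:
  fixes M :: "('s::finite, 'a::finite) nmdp" and \<gamma> :: "('t::finite, 'z::finite, 'a) param"
  assumes "nonlinear_mdp M" "t \<le> horizon M"
  shows "state_pmf M \<zeta> \<gamma> t \<in> pmfs"
  using assms(2)
proof (induction t)
  case 0
  then show ?case using assms(1) by (simp add: nonlinear_mdp_def)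
next
  case (Suc t)
  let ?m = "state_pmf M \<zeta> \<gamma> t"
  have m: "?m \<in> pmfs" using Suc by simp
  have tr: "transition M t ?m s a \<in> pmfs" for s a
    using assms(1) Suc.prems m unfolding nonlinear_mdp_def by simp
  have pol: "policy \<gamma> t z \<in> pmfs" for z unfolding policy_def by (rule softmax_pmfs)
  have "(\<Sum>s'\<in>UNIV. \<Sum>s\<in>UNIV. \<Sum>a\<in>UNIV. ?m $ s * policy \<gamma> t (\<zeta> s) $ a * transition M t ?m s a $ s')
     = (\<Sum>s\<in>UNIV. \<Sum>a\<in>UNIV. \<Sum>s'\<in>UNIV. ?m $ s * policy \<gamma> t (\<zeta> s) $ a * transition M t ?m s a $ s')"
    by (subst sum.swap, rule sum.cong[OF refl], rule sum.swap)
  also have "\<dots> = (\<Sum>s\<in>UNIV. \<Sum>a\<in>UNIV. ?m $ s * policy \<gamma> t (\<zeta> s) $ a)"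
    using tr by (simp add: pmfs_def flip: sum_distrib_left)
  also have "\<dots> = 1" using pol m by (simp add: pmfs_def flip: sum_distrib_left)
  finally show ?case
    using m tr pol by (auto simp: pmfs_def intro!: sum_nonneg mult_nonneg_nonneg)
qed

lemma state_pmf_differentiable:
  fixes M :: "('s::finite, 'a::finite) nmdp" and \<gamma> :: "('t::finite, 'z::finite, 'a) param"
  assumes "nonlinear_mdp M" "t \<le> horizon M"
  shows "(\<lambda>\<gamma>. state_pmf M \<zeta> \<gamma> t $ s) differentiable (at \<gamma>)"
  using assms(2)
proof (induction t arbitrary: s \<gamma>)
  case 0
  then show ?case by simp
next
  case (Suc t s')
  note IH = Suc.IH[OF Suc_leD[OF Suc.prems]]
  have m: "state_pmf M \<zeta> \<gamma> t \<in> pmfs" for \<gamma> :: "('t, 'z, 'a) param"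
    using assms(1) Suc.prems by (intro state_pmf_pmfs) auto
  have "(\<lambda>\<gamma>. state_pmf M \<zeta> \<gamma> t $ s * policy \<gamma> t (\<zeta> s) $ a *
        transition M t (state_pmf M \<zeta> \<gamma> t) s a $ s') differentiable (at \<gamma>)" for s a
  proof (cases "state_pmf M \<zeta> \<gamma> t $ s > 0")
    case True
    let ?D = "{\<mu> \<in> pmfs. \<mu> $ s > 0}" and ?S = "{\<gamma>. state_pmf M \<zeta> \<gamma> t $ s > 0} :: ('t, 'z, 'a) param set"
    have "continuous_on UNIV (\<lambda>\<gamma>::('t, 'z, 'a) param. state_pmf M \<zeta> \<gamma> t $ s)"
      by (intro continuous_at_imp_continuous_on ballI differentiable_imp_continuous_within IH)
    then have S: "open ?S" "\<gamma> \<in> ?S" using True by (auto intro!: open_Collect_less)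
    have "(\<lambda>\<gamma>. state_pmf M \<zeta> \<gamma> t) differentiable (at \<gamma>)"
      by (subst differentiable_componentwise_within) (auto simp: Basis_vec_def inner_axis IH)
    then have 1: "(\<lambda>\<gamma>. state_pmf M \<zeta> \<gamma> t) differentiable (at \<gamma> within ?S)"
      by (rule differentiable_at_withinI)
    have "smooth_extension ?D (\<lambda>\<mu>. transition M t \<mu> s a $ s')"
      using assms(1) Suc.prems unfolding nonlinear_mdp_def by simp
    then have "(\<lambda>\<mu>. transition M t \<mu> s a $ s') differentiable (at (state_pmf M \<zeta> \<gamma> t) within ?D)"
      by (rule smooth_extension_differentiable) (use m True in \<open>auto simp: convex_positive_pmfs\<close>)
    then have 2: "(\<lambda>\<mu>. transition M t \<mu> s a $ s') differentiable
        (at (state_pmf M \<zeta> \<gamma> t) within (\<lambda>\<gamma>. state_pmf M \<zeta> \<gamma> t) ` ?S)"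
      by (rule differentiable_within_subset) (use m in auto)
    have "(\<lambda>\<gamma>. transition M t (state_pmf M \<zeta> \<gamma> t) s a $ s') differentiable (at \<gamma> within ?S)"
      using differentiable_chain_within[OF 1 2] by (simp add: o_def)
    then have "(\<lambda>\<gamma>. transition M t (state_pmf M \<zeta> \<gamma> t) s a $ s') differentiable (at \<gamma>)"
      by (simp only: at_within_open[OF S(2) S(1)])
    then show ?thesis by (intro differentiable_mult policy_differentiable IH)
  next
    case False
    then have 0: "state_pmf M \<zeta> \<gamma> t $ s = 0" using pmfs_ge_0[OF m, of \<gamma> s] by linarith
    have "\<bar>policy \<gamma>' t (\<zeta> s) $ a * transition M t (state_pmf M \<zeta> \<gamma>' t) s a $ s'\<bar> \<le> 1"
      for \<gamma>' :: "('t, 'z, 'a) param"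
    proof -
      have tr: "transition M t (state_pmf M \<zeta> \<gamma>' t) s a \<in> pmfs"
        using assms(1) Suc.prems m unfolding nonlinear_mdp_def by simp
      have pol: "policy \<gamma>' t (\<zeta> s) \<in> pmfs" unfolding policy_def by (rule softmax_pmfs)
      show ?thesis using pmfs_ge_0[OF tr] pmfs_le_1[OF tr] pmfs_ge_0[OF pol] pmfs_le_1[OF pol]
        by (simp add: abs_mult mult_le_one)
    qed
    then have "((\<lambda>\<gamma>. state_pmf M \<zeta> \<gamma> t $ s * (policy \<gamma> t (\<zeta> s) $ a *
        transition M t (state_pmf M \<zeta> \<gamma> t) s a $ s')) has_derivative (\<lambda>_. 0)) (at \<gamma>)"
      by (intro has_derivative_mult_vanishing[of _ _ _ 1] IH 0 pmfs_ge_0[OF m]) auto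
    then show ?thesis unfolding differentiable_def by (auto simp: mult.assoc)
  qed
  then show ?case by (auto intro!: differentiable_sum)
qed

text \<open>In particular \<open>objective_gradient\<close> is the gradient of the objective if the rewards are bounded,
  and if the set of states with positive mass is locally constant at \<open>\<gamma>\<close>.\<close>

lemma objective_gradient_eq:
  fixes M :: "('s::finite, 'a::finite) nmdp" and \<gamma> :: "('t::finite, 'z::finite, 'a) param"
  assumes M: "nonlinear_mdp M"
    and r: "\<And>t s a. t < horizon M \<Longrightarrow> s \<notin> visited M \<zeta> \<gamma> t \<Longrightarrow>
      \<exists>B. eventually (\<lambda>\<gamma>'. s \<notin> visited M \<zeta> \<gamma>' t \<or>
        \<bar>reward M t (state_pmf M \<zeta> \<gamma>' t) s a\<bar> \<le> B) (nhds \<gamma>)"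
    and f: "\<And>s. s \<notin> visited M \<zeta> \<gamma> (horizon M) \<Longrightarrow>
      \<exists>B. eventually (\<lambda>\<gamma>'. s \<notin> visited M \<zeta> \<gamma>' (horizon M) \<or>
        \<bar>final_reward M (state_pmf M \<zeta> \<gamma>' (horizon M)) s\<bar> \<le> B) (nhds \<gamma>)"
  shows "objective_gradient M \<zeta> \<gamma> = gradient (objective M \<zeta>) \<gamma>"
proof -
  let ?T = "horizon M" and ?A = "visited M \<zeta> \<gamma>" and ?m = "state_pmf M \<zeta>"
  let ?O = "objective_over (\<lambda>t. - ?A t) M \<zeta>"
  have pos: "0 \<le> ?m \<gamma>' t $ s" if "t \<le> ?T" for \<gamma>' :: "('t, 'z, 'a) param" and t s
    using pmfs_ge_0[OF state_pmf_pmfs[OF M that]] .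
  have zero: "s \<notin> visited M \<zeta> \<gamma>' t \<longleftrightarrow> ?m \<gamma>' t $ s = 0" if "t \<le> ?T"
    for \<gamma>' :: "('t, 'z, 'a) param" and t s
    using pos[OF that, of \<gamma>' s] by (auto simp: visited_def)
  have run: "((\<lambda>\<gamma>. ?m \<gamma> t $ s * (policy \<gamma> t (\<zeta> s) $ a * reward M t (?m \<gamma> t) s a))
      has_derivative (\<lambda>_. 0)) (at \<gamma>)" if t: "t < ?T" and s: "s \<notin> ?A t" for t s a
  proof -
    obtain B where B: "eventually (\<lambda>\<gamma>'. s \<notin> visited M \<zeta> \<gamma>' t \<or>
        \<bar>reward M t (?m \<gamma>' t) s a\<bar> \<le> B) (nhds \<gamma>)"
      using r[OF t s] by blast
    have pol: "policy \<gamma>' t (\<zeta> s) \<in> pmfs" for \<gamma>' :: "('t, 'z, 'a) param"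
      unfolding policy_def by (rule softmax_pmfs)
    have le: "\<bar>policy \<gamma>' t (\<zeta> s) $ a * x\<bar> \<le> \<bar>x\<bar>" for \<gamma>' :: "('t, 'z, 'a) param" and x
      using pmfs_ge_0[OF pol] pmfs_le_1[OF pol] by (simp add: abs_mult mult_left_le_one_le)
    show ?thesis
    proof (rule has_derivative_mult_vanishing[of _ _ _ B])
      show "\<forall>\<^sub>F \<gamma>' in nhds \<gamma>. ?m \<gamma>' t $ s = 0 \<or>
          \<bar>policy \<gamma>' t (\<zeta> s) $ a * reward M t (?m \<gamma>' t) s a\<bar> \<le> B"
        using B by eventually_elim (use zero t le order_trans in \<open>metis less_imp_le\<close>)
    next
      show "(\<lambda>\<gamma>. ?m \<gamma> t $ s) differentiable (at \<gamma>)"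
        using t by (intro state_pmf_differentiable M) simp
    qed (use pos zero t s in auto)
  qed
  have fin: "((\<lambda>\<gamma>. ?m \<gamma> ?T $ s * final_reward M (?m \<gamma> ?T) s) has_derivative (\<lambda>_. 0)) (at \<gamma>)"
    if s: "s \<notin> ?A ?T" for s
  proof -
    obtain B where B: "eventually (\<lambda>\<gamma>'. s \<notin> visited M \<zeta> \<gamma>' ?T \<or>
        \<bar>final_reward M (?m \<gamma>' ?T) s\<bar> \<le> B) (nhds \<gamma>)"
      using f[OF s] by blast
    show ?thesis
      by (rule has_derivative_mult_vanishing[of _ _ _ B])
        (use B pos zero s in \<open>auto intro: state_pmf_differentiable[OF M]\<close>)
  qed
  have "((\<lambda>\<gamma>. \<Sum>t<?T. \<Sum>s\<in>- ?A t. \<Sum>a\<in>UNIV.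
      ?m \<gamma> t $ s * (policy \<gamma> t (\<zeta> s) $ a * reward M t (?m \<gamma> t) s a))
      has_derivative (\<lambda>_. 0)) (at \<gamma>)"
    by (intro has_derivative_sum_zero run) auto
  moreover have "((\<lambda>\<gamma>. \<Sum>s\<in>- ?A ?T. ?m \<gamma> ?T $ s * final_reward M (?m \<gamma> ?T) s)
      has_derivative (\<lambda>_. 0)) (at \<gamma>)"
    by (intro has_derivative_sum_zero fin) auto
  ultimately have O: "(?O has_derivative (\<lambda>_. 0)) (at \<gamma>)"
    unfolding objective_over_def mult.assoc by (drule_tac has_derivative_add) (assumption, simp)
  have split: "objective M \<zeta> = (\<lambda>\<gamma>' :: ('t, 'z, 'a) param.
      objective_over ?A M \<zeta> \<gamma>' + ?O \<gamma>')"
  proof (rule ext)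
    fix \<gamma>' :: "('t, 'z, 'a) param"
    have "sum h UNIV = sum h (?A t) + sum h (- ?A t)" for h :: "'s \<Rightarrow> real" and t
      by (subst sum.union_disjoint[symmetric]) (auto simp: Compl_partition)
    note sp = this
    have "(\<Sum>t<?T. sum (h t) UNIV) = (\<Sum>t<?T. sum (h t) (?A t)) + (\<Sum>t<?T. sum (h t) (- ?A t))"
      for h :: "nat \<Rightarrow> 's \<Rightarrow> real"
      unfolding sum.distrib[symmetric] by (intro sum.cong refl sp)
    note sp' = this
    show "objective M \<zeta> \<gamma>' = objective_over ?A M \<zeta> \<gamma>' + ?O \<gamma>'"
      unfolding objective_def objective_over_def sp'
        sp[of "\<lambda>s. ?m \<gamma>' ?T $ s * final_reward M (?m \<gamma>' ?T) s" ?T]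
      by simp
  qed
  have "(objective M \<zeta> has_derivative D) (at \<gamma>) \<longleftrightarrow>
      (objective_over ?A M \<zeta> has_derivative D) (at \<gamma>)" for D
    using has_derivative_add[OF _ O, of "objective_over ?A M \<zeta>" D]
      has_derivative_diff[OF _ O, of "objective M \<zeta>" D]
    unfolding split by auto
  then have "gderiv (objective M \<zeta>) \<gamma> = gderiv (objective_over ?A M \<zeta>) \<gamma>"
    by (intro ext) (simp add: gderiv_def)
  then show ?thesis unfolding objective_gradient_def gradient_def by simp
qed


section \<open>Natural gradients\<close>

definition trajectories :: "('s::finite, 'a::finite) nmdp \<Rightarrow> ((nat \<Rightarrow> 's) \<times> (nat \<Rightarrow> 'a)) set" where
  "trajectories M = ({..horizon M} \<rightarrow>\<^sub>E UNIV) \<times> ({..<horizon M} \<rightarrow>\<^sub>E UNIV)"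

definition trajectory_pmf :: "('s::finite, 'a::finite) nmdp \<Rightarrow> ('s \<Rightarrow> 'z::finite)
    \<Rightarrow> ('t::finite, 'z, 'a) param \<Rightarrow> (nat \<Rightarrow> 's) \<times> (nat \<Rightarrow> 'a) \<Rightarrow> real" where
  "trajectory_pmf M \<zeta> \<gamma> = (\<lambda>(\<sigma>, \<alpha>). init_pmf M $ \<sigma> 0 *
     (\<Prod>t<horizon M. policy \<gamma> t (\<zeta> (\<sigma> t)) $ \<alpha> t *
        transition M t (state_pmf M \<zeta> \<gamma> t) (\<sigma> t) (\<alpha> t) $ \<sigma> (Suc t)))"

text \<open>At trajectories of probability zero the logarithm and its gradient are junk values, but
  there the weight is zero as well.\<close>

definition fisher :: "('s::finite, 'a::finite) nmdp \<Rightarrow> ('s \<Rightarrow> 'z::finite)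
    \<Rightarrow> ('t::finite, 'z, 'a) param \<Rightarrow> real ^ ('t \<times> 'z \<times> 'a) ^ ('t \<times> 'z \<times> 'a)" where
  "fisher M \<zeta> \<gamma> = (\<Sum>\<tau>\<in>trajectories M.
     let v = gradient (\<lambda>\<gamma>'. ln (trajectory_pmf M \<zeta> \<gamma>' \<tau>)) \<gamma>
     in trajectory_pmf M \<zeta> \<gamma> \<tau> *\<^sub>R outer v v)"

definition softmax_fisher :: "real ^ 'a::finite \<Rightarrow> real ^ 'a ^ 'a" where
  "softmax_fisher \<psi> = (\<Sum>a\<in>UNIV.
     let v = gradient (\<lambda>\<psi>'. ln (softmax \<psi>' $ a)) \<psi>
     in (softmax \<psi> $ a) *\<^sub>R outer v v)"

definition approx_fisher :: "('s::finite, 'a::finite) nmdp \<Rightarrow> ('s \<Rightarrow> 'z::finite)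
    \<Rightarrow> ('t::finite, 'z, 'a) param \<Rightarrow> real ^ ('t \<times> 'z \<times> 'a) ^ ('t \<times> 'z \<times> 'a)" where
  "approx_fisher M \<zeta> \<gamma> = (\<chi> k l. case k of (i, z, a) \<Rightarrow> case l of (i', z', a') \<Rightarrow>
     if i = i' \<and> z = z'
     then block_mass \<zeta> (state_pmf M \<zeta> \<gamma> (to_nat_on UNIV i)) z *
          softmax_fisher (block \<gamma> (to_nat_on UNIV i) z) $ a $ a'
     else 0)"

definition natural_gradient :: "('s::finite, 'a::finite) nmdp \<Rightarrow> ('s \<Rightarrow> 'z::finite)
    \<Rightarrow> ('t::finite, 'z, 'a) param \<Rightarrow> ('t, 'z, 'a) param" where
  "natural_gradient M \<zeta> \<gamma> = pinv (fisher M \<zeta> \<gamma>) *v objective_gradient M \<zeta> \<gamma>"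

definition approx_natural_gradient :: "('s::finite, 'a::finite) nmdp \<Rightarrow> ('s \<Rightarrow> 'z::finite)
    \<Rightarrow> ('t::finite, 'z, 'a) param \<Rightarrow> ('t, 'z, 'a) param" where
  "approx_natural_gradient M \<zeta> \<gamma> = pinv (approx_fisher M \<zeta> \<gamma>) *v objective_gradient M \<zeta> \<gamma>"

end

theory Submission
  imports Defs
begin

text \<open>Write \<open>A\<close> for the approximate Fisher matrix at \<open>\<gamma> n\<close>, \<open>F\<close> for the Fisher matrix and \<open>g\<close> for the
  gradient of the objective. The proof shows that \<open>F = A + A Y A\<close> and \<open>g = A h\<close>, where the symmetric
  matrix \<open>Y\<close> and the vector \<open>h\<close> stay bounded along the sequence while \<open>A\<close> tends to \<open>0\<close>. The
  approximate natural gradient is then the projection of \<open>h\<close> onto the range of \<open>A\<close>, and since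
  \<open>F = A (1 + Y A)\<close> with \<open>Y A\<close> tending to \<open>0\<close>, the matrix \<open>F\<close> has the same range and null space as \<open>A\<close>
  and the natural gradient has the same limiting behaviour (\<open>pinv_perturbation\<close>).

  \<^emph>\<open>Why \<open>A\<close> tends to \<open>0\<close>.\<close> Its blocks are multiples, by masses at most \<open>1\<close>, of the covariance matrix
  \<open>diag p - p p\<^sup>T\<close> of the policy \<open>p\<close>, which vanishes when \<open>p\<close> is concentrated at one action
  (\<open>approx_fisher_tendsto_0\<close>).

  \<^emph>\<open>Why \<open>F = A + A Y A\<close>.\<close> The score of a trajectory is the sum over time of a policy score and a
  transition score; the latter is present because the transition probabilities depend on the
  parameter through the state distribution. Both have conditional mean zero given the past, and
  the transition score even given the current action, so all correlations between different terms
  vanish. The policy scores contribute \<open>A\<close>, and \<open>F - A\<close> is the covariance of the transition scores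
  (\<open>fisher_nth\<close>). It has the form \<open>A Y A\<close> if every transition score is \<open>A y\<close> with bounded \<open>y\<close>.

  \<^emph>\<open>Why gradients have the form \<open>A y\<close>.\<close> A function of the policy has as its gradient in softmax
  coordinates the gradient in the action probabilities, multiplied by \<open>diag p - p p\<^sup>T\<close> in each block.
  On a block whose mass stays away from zero this is multiplication by \<open>A\<close>, up to a bounded factor. The
  functions with such gradients are closed under sums, products and composition with smooth
  functions (predicate \<open>gradient_factors\<close>), hence contain the state masses, the transition
  probabilities and the objective. The constancy of the supports keeps every argument of a
  transition probability or reward convergent to a point where the extended gradient is
  continuous, and keeps the positive transition probabilities away from zero, which is needed for
  their logarithms.\<close>

section \<open>Moore-Penrose inverses of symmetric matrices\<close>

lemma symmetric_inner:
  fixes A :: "real ^ 'n ^ 'n"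
  assumes "transpose A = A"
  shows "inner (A *v x) y = inner x (A *v y)"
  by (metis assms dot_lmul_matrix vector_transpose_matrix)

lemma transpose_zero: "transpose 0 = 0"
  by (simp add: transpose_def vec_eq_iff)

lemma transpose_add: "transpose (A + B) = transpose A + transpose B"
  by (simp add: transpose_def vec_eq_iff)

lemma matrix_add_rdistrib:
  fixes A B :: "real ^ 'n ^ 'm"
  shows "(A + B) ** C = A ** C + B ** C"
  by (simp add: matrix_matrix_mult_def vec_eq_iff sum.distrib algebra_simps)

lemma inj_matrix_imp_inverse:
  fixes A :: "real ^ 'n ^ 'n"
  assumes "\<And>v. A *v v = 0 \<Longrightarrow> v = 0"
  obtains Z where "A ** Z = mat 1" "Z ** A = mat 1"
proof -
  obtain Z where "Z ** A = mat 1"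
    using matrix_left_invertible_ker[of A] assms by blast
  then show thesis using that matrix_left_right_inverse by blast
qed

definition moore_penrose :: "real ^ 'n::finite ^ 'm::finite \<Rightarrow> real ^ 'm ^ 'n \<Rightarrow> bool" where
  "moore_penrose A X \<longleftrightarrow> A ** X ** A = A \<and> X ** A ** X = X \<and>
     transpose (A ** X) = A ** X \<and> transpose (X ** A) = X ** A"

lemma moore_penrose_unique:
  assumes X: "moore_penrose A X" and Y: "moore_penrose A Y"
  shows "X = Y"
proof -
  \<comment> \<open>Two projections with the same range that are both orthogonal are equal.\<close>
  have "A ** X = transpose (A ** X)" using X by (simp add: moore_penrose_def)
  also have "\<dots> = transpose ((A ** Y) ** (A ** X))"
    using Y by (simp add: moore_penrose_def matrix_mul_assoc)
  also have "\<dots> = (A ** X) ** (A ** Y)"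
    using X Y by (simp add: moore_penrose_def matrix_transpose_mul del: transpose_matrix_vector)
  also have "\<dots> = A ** Y" using X by (simp add: moore_penrose_def matrix_mul_assoc)
  finally have AX: "A ** X = A ** Y" .
  have "X ** A = transpose (X ** A)" using X by (simp add: moore_penrose_def)
  also have "\<dots> = transpose ((X ** A) ** (Y ** A))"
    using Y by (metis matrix_mul_assoc moore_penrose_def)
  also have "\<dots> = (Y ** A) ** (X ** A)"
    using X Y by (metis moore_penrose_def matrix_transpose_mul)
  also have "\<dots> = Y ** A" using X by (metis moore_penrose_def matrix_mul_assoc)
  finally have XA: "X ** A = Y ** A" .
  have "X = X ** (A ** X)" using X by (metis moore_penrose_def matrix_mul_assoc)
  also have "\<dots> = Y ** (A ** Y)" using AX XA by (metis matrix_mul_assoc)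
  also have "\<dots> = Y" using Y by (metis moore_penrose_def matrix_mul_assoc)
  finally show ?thesis .
qed

text \<open>With \<open>Q\<close> the orthogonal projection onto the null space of \<open>A\<close>, the matrix \<open>A + Q\<close> is
  invertible and commutes with \<open>Q\<close>, and \<open>(A + Q)\<^sup>-\<^sup>1 - Q\<close> inverts \<open>A\<close> on its range and vanishes
  on its null space.\<close>

lemma moore_penrose_exists:
  fixes A :: "real ^ 'n ^ 'n"
  assumes sym: "transpose A = A"
  shows "\<exists>X. moore_penrose A X"
proof -
  let ?N = "{v. A *v v = 0}"
  have "subspace ?N" by (intro linear_subspace_kernel matrix_vector_mul_linear)
  then obtain B where B: "B \<subseteq> ?N" "pairwise orthogonal B" "\<And>b. b \<in> B \<Longrightarrow> norm b = 1"
    "independent B" "span B = ?N"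
    using orthonormal_basis_subspace by metis
  have finB: "finite B" using B(4) by (rule independent_imp_finite)
  define Q :: "real ^ 'n ^ 'n" where "Q = (\<Sum>b\<in>B. outer b b)"
  have Qv: "Q *v v = (\<Sum>b\<in>B. inner b v *\<^sub>R b)" for v
    unfolding Q_def by (simp add: vec_eq_iff matrix_vector_mult_def outer_def sum_component inner_vec_def
        sum_distrib_left sum_distrib_right sum.swap[of _ B] mult_ac)
  have AQ: "A ** Q = 0"
  proof -
    have "A *v (Q *v v) = 0" for v
      unfolding Qv using B(1) by (simp add: linear_sum[OF matrix_vector_mul_linear] matrix_vector_mult_scaleR
          subset_eq)
    then show ?thesis by (simp add: matrix_eq matrix_vector_mul_assoc)
  qed
  have Qsym: "transpose Q = Q"
    unfolding Q_def by (simp add: vec_eq_iff transpose_def outer_def sum_component mult.commute)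
  have QA: "Q ** A = 0"
    using AQ sym Qsym by (metis matrix_transpose_mul transpose_zero)
  have Qid: "Q *v v = v" if "A *v v = 0" for v
  proof (rule linear_eq_on_span[where B = B and f = "(*v) Q" and g = "\<lambda>v. v"])
    fix b assume b: "b \<in> B"
    have "inner c b *\<^sub>R c = (if c = b then b else 0)" if "c \<in> B" for c
      using that b B(2,3) by (auto simp: pairwise_def orthogonal_def dot_square_norm)
    then show "Q *v b = b" unfolding Qv using finB b by simp
  qed (use that B(5) in \<open>auto simp: linear_ident\<close>)
  have QQ: "Q ** Q = Q"
    using AQ by (metis Qid matrix_eq matrix_vector_mul_assoc matrix_vector_mult_0)
  have inj: "v = 0" if "(A + Q) *v v = 0" for v
  proof -
    have "Q *v v = Q *v ((A + Q) *v v)"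
      by (simp add: matrix_vector_mul_assoc matrix_add_ldistrib QA QQ)
    also have "\<dots> = 0" using that by simp
    finally have "Q *v v = 0" .
    moreover from this have "A *v v = 0" using that by (simp add: matrix_vector_mult_add_rdistrib)
    ultimately show ?thesis using Qid by simp
  qed
  obtain Z where Z: "(A + Q) ** Z = mat 1" "Z ** (A + Q) = mat 1"
    using inj_matrix_imp_inverse[of "A + Q"] inj by blast
  have "Q ** ((A + Q) ** Z) = Q ** Z" by (simp add: matrix_mul_assoc matrix_add_ldistrib QA QQ)
  then have QZ: "Q ** Z = Q" by (simp add: Z)
  have "(Z ** (A + Q)) ** Q = Z ** Q"
    by (simp add: matrix_mul_assoc[symmetric] matrix_add_rdistrib AQ QQ)
  then have ZQ: "Z ** Q = Q" by (simp add: Z)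
  have AZ: "A ** Z = mat 1 - Q" using Z(1) QZ by (simp add: matrix_add_rdistrib algebra_simps)
  have ZA: "Z ** A = mat 1 - Q" using Z(2) ZQ by (simp add: matrix_add_ldistrib algebra_simps)
  have sub: "A ** (Z - Q) = mat 1 - Q" "(Z - Q) ** A = mat 1 - Q"
    using AZ AQ ZA QA matrix_add_ldistrib[of A "Z - Q" Q] matrix_add_rdistrib[of "Z - Q" Q A] by simp_all
  have PA: "(mat 1 - Q) ** A = A"
    using matrix_add_rdistrib[of "mat 1 - Q" Q A] QA by simp
  have PX: "(mat 1 - Q) ** (Z - Q) = Z - Q"
    using matrix_add_rdistrib[of "mat 1 - Q" Q "Z - Q"] matrix_add_ldistrib[of Q "Z - Q" Q] QZ QQ by simp
  have "transpose (mat 1 - Q) = mat 1 - Q"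
    using Qsym by (simp add: vec_eq_iff transpose_def mat_def)
  then have "moore_penrose A (Z - Q)" unfolding moore_penrose_def by (simp add: sub PA PX)
  then show ?thesis by blast
qed

lemma pinv_moore_penrose: "transpose A = A \<Longrightarrow> moore_penrose A (pinv A)"
  using moore_penrose_exists[of A] moore_penrose_unique[of A]
  unfolding pinv_def moore_penrose_def[symmetric] by (metis theI)

text \<open>The range of \<open>F = A (1 + Y A)\<close> is that of \<open>A\<close>, since \<open>1 + Y A\<close> is invertible. On this range
  \<open>x = pinv F (A h)\<close> solves \<open>x + P Y A x = pinv A (A h)\<close>, where \<open>P = pinv A A\<close> is the orthogonal
  projection, so the two vectors differ by the small vector \<open>P Y A x\<close>. The factor \<open>A\<close> has been cancelled
  before any estimate is made, because \<open>A\<close> may have arbitrarily small nonzero eigenvalues.\<close>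

lemma pinv_perturbation:
  fixes A Y :: "real ^ 'n ^ 'n"
  assumes symA: "transpose A = A" and symY: "transpose Y = Y"
    and small: "\<And>v. norm ((Y ** A) *v v) \<le> \<epsilon> * norm v" and \<epsilon>: "\<epsilon> \<le> 1 / 2"
  shows "norm (pinv (A + A ** Y ** A) *v (A *v h) - pinv A *v (A *v h)) \<le> 2 * \<epsilon> * norm h"
proof -
  define F where "F = A + A ** Y ** A"
  define K where "K = mat 1 + Y ** A"
  define P where "P = pinv A ** A"
  define x where "x = pinv F *v (A *v h)"
  have FAK: "F = A ** K"
    by (simp add: F_def K_def matrix_add_ldistrib matrix_mul_assoc)
  have "transpose (A ** Y ** A) = A ** Y ** A"
    by (metis matrix_mul_assoc matrix_transpose_mul symA symY)
  then have symF: "transpose F = F"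
    unfolding F_def transpose_add using symA by simp
  note pA = pinv_moore_penrose[OF symA, unfolded moore_penrose_def]
  note pF = pinv_moore_penrose[OF symF, unfolded moore_penrose_def]
  have PA: "P ** A = A"
    using arg_cong[where f = transpose, of "A ** pinv A ** A" A] pA symA
    unfolding P_def by (metis matrix_mul_assoc matrix_transpose_mul)
  have PP: "P ** P = P" using pA by (simp add: P_def matrix_mul_assoc)
  have symP: "transpose P = P" using pA by (simp add: P_def)
  have normP: "norm (P *v v) \<le> norm v" for v
  proof -
    have "(norm (P *v v))\<^sup>2 = inner v (P *v v)"
      unfolding power2_norm_eq_inner symmetric_inner[OF symP] by (simp add: matrix_vector_mul_assoc PP)
    also have "\<dots> \<le> norm v * norm (P *v v)" by (rule norm_cauchy_schwarz)
    finally show ?thesis by (cases "norm (P *v v) = 0") (auto simp: power2_eq_square)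
  qed
  have K0: "v = 0" if "K *v v = 0" for v
  proof -
    have "v = - ((Y ** A) *v v)"
      using that by (simp add: K_def matrix_vector_mult_add_rdistrib add_eq_0_iff)
    then have "norm v \<le> \<epsilon> * norm v" using small[of v] by (metis norm_minus_cancel)
    also have "\<dots> \<le> 1 / 2 * norm v" using \<epsilon> by (intro mult_right_mono) auto
    finally show ?thesis by simp
  qed
  obtain K' where K': "K ** K' = mat 1" using inj_matrix_imp_inverse[of K] K0 by blast
  define u where "u = K' *v h"
  have Ah: "A *v h = F *v u"
    by (simp add: u_def FAK matrix_vector_mul_assoc matrix_mul_assoc[symmetric] K')
  have Fx: "F *v x = A *v h"
    unfolding x_def Ah using pF by (simp add: matrix_vector_mul_assoc matrix_mul_assoc)
  \<comment> \<open>The range of \<open>pinv F\<close> is that of \<open>F\<close> by symmetry, hence contained in the range of \<open>A\<close>.\<close>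
  have "pinv F = transpose (pinv F ** F) ** pinv F" using pF by simp
  then have "pinv F = F ** transpose (pinv F) ** pinv F"
    by (simp add: matrix_transpose_mul symF)
  then have "P ** pinv F = pinv F" using PA FAK by (metis matrix_mul_assoc)
  then have Px: "P *v x = x"
    unfolding x_def by (metis matrix_vector_mul_assoc)
  have "pinv A *v (A *v h) = pinv A *v (F *v x)" by (simp only: Fx)
  also have "\<dots> = P *v (x + (Y ** A) *v x)"
    by (simp add: FAK K_def P_def matrix_vector_mul_assoc matrix_mul_assoc matrix_vector_mult_add_rdistrib
        matrix_add_ldistrib matrix_vector_right_distrib)
  also have "\<dots> = x + P *v ((Y ** A) *v x)" by (simp add: Px matrix_vector_right_distrib)
  finally have eq: "pinv A *v (A *v h) = x + P *v ((Y ** A) *v x)" .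
  have 1: "norm (P *v ((Y ** A) *v x)) \<le> \<epsilon> * norm x"
    using normP[of "(Y ** A) *v x"] small[of x] by linarith
  have "norm (x + P *v ((Y ** A) *v x)) \<le> norm h"
    using normP[of h] eq unfolding P_def matrix_vector_mul_assoc by metis
  then have "norm x \<le> norm h + \<epsilon> * norm x"
    using 1 norm_triangle_ineq4[of "x + P *v ((Y ** A) *v x)" "P *v ((Y ** A) *v x)"] by simp
  moreover have "\<epsilon> * norm x \<le> 1 / 2 * norm x" using \<epsilon> by (intro mult_right_mono) auto
  ultimately have x: "norm x \<le> 2 * norm h" by simp
  have "0 \<le> \<epsilon>" if "h \<noteq> 0" using small[of h] that
    by (meson norm_ge_zero order_trans zero_le_mult_iff zero_less_norm_iff linorder_not_le)
  then have "\<epsilon> * norm x \<le> \<epsilon> * (2 * norm h)"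
    using x by (cases "h = 0") (auto intro: mult_left_mono)
  moreover have "x - pinv A *v (A *v h) = - (P *v ((Y ** A) *v x))" by (simp add: eq)
  ultimately show ?thesis using 1 by (simp add: x_def[symmetric] F_def[symmetric])
qed

lemma matrix_vector_mult_sum:
  fixes N :: "'i \<Rightarrow> real ^ 'n ^ 'm"
  shows "(\<Sum>i\<in>I. N i) *v v = (\<Sum>i\<in>I. N i *v v)"
  by (induction I rule: infinite_finite_induct) (auto simp: matrix_vector_mult_add_rdistrib)

lemma outer_mult_vector: "outer v w *v x = inner w x *\<^sub>R v"
  by (simp add: vec_eq_iff matrix_vector_mult_def outer_def inner_vec_def sum_distrib_left mult_ac)

lemma sum_outer_congruence:
  fixes A :: "real ^ 'n ^ 'n"
  assumes "transpose A = A"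
  shows "(\<Sum>i\<in>I. c i *\<^sub>R outer (A *v y i) (A *v y i)) = A ** (\<Sum>i\<in>I. c i *\<^sub>R outer (y i) (y i)) ** A"
  by (simp add: matrix_eq matrix_vector_mult_sum matrix_vector_mul_assoc[symmetric] outer_mult_vector
      scaleR_matrix_vector_assoc[symmetric] linear_sum[OF matrix_vector_mul_linear]
      matrix_vector_mult_scaleR symmetric_inner[OF assms])

lemma norm_sum_outer_mult_le:
  fixes y :: "'i \<Rightarrow> real ^ 'n"
  assumes "\<And>i. i \<in> I \<Longrightarrow> 0 \<le> c i \<and> c i \<le> 1" "\<And>i. i \<in> I \<Longrightarrow> norm (y i) \<le> C i"
  shows "norm ((\<Sum>i\<in>I. c i *\<^sub>R outer (y i) (y i)) *v v) \<le> (\<Sum>i\<in>I. (C i)\<^sup>2) * norm v"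
proof -
  have "norm (c i *\<^sub>R inner (y i) v *\<^sub>R y i) \<le> (C i)\<^sup>2 * norm v" if i: "i \<in> I" for i
  proof -
    have "norm (c i *\<^sub>R inner (y i) v *\<^sub>R y i) \<le> 1 * ((norm (y i) * norm v) * norm (y i))"
      unfolding norm_scaleR using assms(1)[OF i]
      by (intro mult_mono Cauchy_Schwarz_ineq2) (auto simp: Cauchy_Schwarz_ineq2)
    also have "\<dots> = (norm (y i))\<^sup>2 * norm v" by (simp add: power2_eq_square)
    also have "\<dots> \<le> (C i)\<^sup>2 * norm v"
      using assms(2)[OF i] by (intro mult_right_mono power_mono) auto
    finally show ?thesis .
  qed
  then show ?thesis
    by (simp add: matrix_vector_mult_sum outer_mult_vector scaleR_matrix_vector_assoc[symmetric] sum_distrib_right)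
      (rule order_trans[OF norm_sum sum_mono], simp)
qed

section \<open>Gradients of smoothly extendable functions\<close>

lemma gradient_eqI:
  assumes "GDERIV f x :> D"
  shows "gradient f x = D"
  unfolding gradient_def
proof (rule the_equality)
  show "GDERIV f x :> D" by (rule assms)
next
  fix D' assume "GDERIV f x :> D'"
  then have "(\<lambda>h. inner h D') = (\<lambda>h. inner h D)"
    using assms unfolding gderiv_def by (rule has_derivative_unique)
  then show "D' = D" by (metis vector_eq_ldot)
qed

text \<open>A local Lipschitz bound on the relative interior passes to the boundary points in \<open>D\<close> by density,
  because the function itself is continuous there.\<close>

lemma lipschitz_rel_interior_extends:
  fixes k :: "'v::euclidean_space \<Rightarrow> real"
  assumes "convex D" and k: "continuous_on D k"
    and lip: "\<And>u v. u \<in> rel_interior D \<Longrightarrow> v \<in> rel_interior D \<Longrightarrow> dist x u < d \<Longrightarrow> dist x v < d \<Longrightarrow>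
      \<bar>k u - k v\<bar> \<le> e * dist u v"
    and u: "u \<in> D" "dist x u < d" and v: "v \<in> D" "dist x v < d"
  shows "\<bar>k u - k v\<bar> \<le> e * dist u v"
proof -
  have approx: "\<exists>p. (\<forall>j. p j \<in> rel_interior D) \<and> p \<longlonglongrightarrow> w" if "w \<in> D" for w
  proof -
    have "w \<in> closure (rel_interior D)"
      using that convex_closure_rel_interior[OF assms(1)] closure_subset by blast
    then show ?thesis by (simp add: closure_sequential)
  qed
  obtain p where p: "\<And>j. p j \<in> rel_interior D" "p \<longlonglongrightarrow> u" using approx[OF u(1)] by blast
  obtain q where q: "\<And>j. q j \<in> rel_interior D" "q \<longlonglongrightarrow> v" using approx[OF v(1)] by blast
  have D: "rel_interior D \<subseteq> D" by (rule rel_interior_subset)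
  have kp: "(\<lambda>j. k (p j)) \<longlonglongrightarrow> k u"
    using p D by (intro continuous_on_tendsto_compose[OF k p(2) u(1)]) (auto intro!: always_eventually)
  have kq: "(\<lambda>j. k (q j)) \<longlonglongrightarrow> k v"
    using q D by (intro continuous_on_tendsto_compose[OF k q(2) v(1)]) (auto intro!: always_eventually)
  have np: "eventually (\<lambda>j. dist x (p j) < d) sequentially"
    using u(2) by (intro order_tendstoD(2)[OF tendsto_dist[OF tendsto_const p(2)]])
  have nq: "eventually (\<lambda>j. dist x (q j) < d) sequentially"
    using v(2) by (intro order_tendstoD(2)[OF tendsto_dist[OF tendsto_const q(2)]])
  show ?thesis
  proof (rule tendsto_le[OF sequentially_bot])
    show "(\<lambda>j. e * dist (p j) (q j)) \<longlonglongrightarrow> e * dist u v" by (intro tendsto_intros p q)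
    show "(\<lambda>j. \<bar>k (p j) - k (q j)\<bar>) \<longlonglongrightarrow> \<bar>k u - k v\<bar>" by (intro tendsto_intros kp kq)
    show "eventually (\<lambda>j. \<bar>k (p j) - k (q j)\<bar> \<le> e * dist (p j) (q j)) sequentially"
      using np nq by eventually_elim (intro lip p q)
  qed
qed

text \<open>The gradient field of the extension is a derivative relative to \<open>D\<close> even at boundary points:
  near \<open>x\<close> the function minus its linearisation has small gradient on the relative interior, hence
  a small Lipschitz constant there, and by density on all of \<open>D\<close>.\<close>

lemma smooth_extension_gradient:
  fixes f :: "real ^ 'i::finite \<Rightarrow> real"
  assumes f: "smooth_extension D f" and D: "convex D"
  obtains G where "continuous_on D G"
    "\<And>x. x \<in> D \<Longrightarrow> (f has_derivative (\<lambda>h. inner h (G x))) (at x within D)"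
proof -
  obtain U g G where U: "open U" "rel_interior D \<subseteq> U" and gf: "\<And>x. x \<in> D \<Longrightarrow> g x = f x"
    and cg: "continuous_on (U \<union> D) g" and Gd: "\<And>x. x \<in> U \<Longrightarrow> GDERIV g x :> G x"
    and cG: "continuous_on (U \<union> D) G"
    using f unfolding smooth_extension_def by metis
  have "(f has_derivative (\<lambda>h. inner h (G x))) (at x within D)" if x: "x \<in> D" for x
    unfolding has_derivative_within_alt
  proof (intro conjI allI impI)
    show "bounded_linear (\<lambda>h. inner h (G x))" by (rule bounded_linear_inner_left)
    fix e :: real assume e: "e > 0"
    obtain d where d: "d > 0" "\<And>y. y \<in> U \<union> D \<Longrightarrow> dist y x < d \<Longrightarrow> dist (G y) (G x) < e"
      using cG x e unfolding continuous_on_iff by blast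
    define k where "k = (\<lambda>u. g u - inner u (G x))"
    let ?V = "rel_interior D \<inter> ball x d"
    have V: "convex ?V" using D by (simp add: convex_rel_interior convex_Int)
    have ck: "continuous_on D k"
      unfolding k_def by (intro continuous_intros continuous_on_subset[OF cg]) auto
    have bound: "\<bar>k u - k v\<bar> \<le> e * dist u v" if "u \<in> ?V" "v \<in> ?V" for u v
      unfolding dist_norm real_norm_def[symmetric]
    proof (rule differentiable_bound[OF V _ _ that])
      fix y assume y: "y \<in> ?V"
      then show "(k has_derivative (\<lambda>h. inner h (G y) - inner h (G x))) (at y within ?V)"
        unfolding k_def using Gd[of y] U(2) unfolding gderiv_def
        by (intro has_derivative_diff bounded_linear_imp_has_derivative bounded_linear_inner_left)
          (blast intro: has_derivative_at_withinI)
      show "onorm (\<lambda>h. inner h (G y) - inner h (G x)) \<le> e"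
      proof (rule onorm_le)
        fix h
        have "norm (inner h (G y) - inner h (G x)) \<le> norm h * norm (G y - G x)"
          by (simp add: Cauchy_Schwarz_ineq2 flip: inner_diff_right)
        also have "\<dots> \<le> norm h * e"
          using d(2)[of y] y U(2) by (intro mult_left_mono) (auto simp: dist_norm norm_minus_commute)
        finally show "norm (inner h (G y) - inner h (G x)) \<le> e * norm h" by (simp add: mult.commute)
      qed
    qed
    have "norm (f y - f x - inner (y - x) (G x)) \<le> e * norm (y - x)"
      if y: "y \<in> D" "norm (y - x) < d" for y
    proof -
      have "\<bar>k y - k x\<bar> \<le> e * dist y x"
        by (rule lipschitz_rel_interior_extends[OF D ck, where x = x and d = d])
          (use bound y x d(1) in \<open>auto simp: dist_norm norm_minus_commute\<close>)
      then show ?thesis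
        using x y by (simp add: k_def gf dist_norm inner_diff_left algebra_simps)
    qed
    then show "\<exists>d>0. \<forall>y\<in>D. norm (y - x) < d \<longrightarrow>
        norm (f y - f x - inner (y - x) (G x)) \<le> e * norm (y - x)"
      using d(1) by blast
  qed
  moreover have "continuous_on D G" by (rule continuous_on_subset[OF cG]) simp
  ultimately show thesis using that by blast
qed

lemma gderiv_sum:
  "(\<And>i. i \<in> I \<Longrightarrow> GDERIV (f i) x :> d i) \<Longrightarrow> GDERIV (\<lambda>x. \<Sum>i\<in>I. f i x) x :> (\<Sum>i\<in>I. d i)"
  unfolding gderiv_def inner_sum_right by (rule has_derivative_sum)

lemma differentiable_imp_gderiv:
  fixes f :: "'v::euclidean_space \<Rightarrow> real"
  assumes "f differentiable (at x)"
  obtains d where "GDERIV f x :> d"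
proof -
  obtain f' where f': "(f has_derivative f') (at x)" using assms unfolding differentiable_def by blast
  then interpret bounded_linear f' by (rule has_derivative_bounded_linear)
  have "f' h = inner h (\<Sum>b\<in>Basis. f' b *\<^sub>R b)" for h
  proof -
    have "f' h = f' (\<Sum>b\<in>Basis. inner h b *\<^sub>R b)" by (simp add: euclidean_representation)
    also have "\<dots> = (\<Sum>b\<in>Basis. inner h b * f' b)" by (simp only: sum scaleR real_scaleR_def)
    finally show ?thesis by (simp add: inner_sum_right mult.commute)
  qed
  then have "f' = (\<lambda>h. inner h (\<Sum>b\<in>Basis. f' b *\<^sub>R b))" by (rule ext)
  then have "GDERIV f x :> (\<Sum>b\<in>Basis. f' b *\<^sub>R b)" using f' unfolding gderiv_def by metis
  then show thesis by (rule that)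
qed

lemma gderiv_prod_log:
  assumes "finite I" "\<And>i. i \<in> I \<Longrightarrow> GDERIV (f i) x :> f i x *\<^sub>R d i"
  shows "GDERIV (\<lambda>x. \<Prod>i\<in>I. f i x) x :> (\<Prod>i\<in>I. f i x) *\<^sub>R (\<Sum>i\<in>I. d i)"
  using assms
proof (induction I)
  case empty
  then show ?case by (simp add: GDERIV_const)
next
  case (insert j I)
  have "GDERIV (\<lambda>x. f j x * (\<Prod>i\<in>I. f i x)) x :>
      f j x *\<^sub>R (\<Prod>i\<in>I. f i x) *\<^sub>R (\<Sum>i\<in>I. d i) + (\<Prod>i\<in>I. f i x) *\<^sub>R f j x *\<^sub>R d j"
    using insert by (intro GDERIV_mult) auto
  then show ?case using insert(1,2) by (simp add: scaleR_right_distrib mult.commute add.commute)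
qed

text \<open>A transition probability that is zero at \<open>\<gamma>\<close> is at a minimum there. Hence it may be kept in sums of
  derivatives although its logarithm has no gradient.\<close>

lemma gderiv_min_zero:
  fixes f :: "'v::euclidean_space \<Rightarrow> real"
  assumes "GDERIV f x :> d" "f x = 0" "\<And>y. 0 \<le> f y"
  shows "d = 0"
proof -
  have "(\<lambda>h. inner h d) = (\<lambda>_. 0)"
    by (rule differential_zero_maxmin[of x UNIV f]) (use assms in \<open>auto simp: gderiv_def\<close>)
  then show ?thesis by (metis inner_eq_zero_iff)
qed

text \<open>The derivative of \<open>f\<close> is only relative to the set of pmfs charging \<open>s\<close>, but the inner function takes its
  values in that set near \<open>x\<close>, so the composition has a full gradient.\<close>

lemma gderiv_smooth_compose:
  fixes m :: "'v::euclidean_space \<Rightarrow> real ^ 's::finite" and f :: "real ^ 's \<Rightarrow> real"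
  assumes m: "\<And>x. m x \<in> pmfs" and pos: "m x $ s > 0"
    and d: "\<And>\<sigma>. GDERIV (\<lambda>x. m x $ \<sigma>) x :> d \<sigma>"
    and f: "(f has_derivative (\<lambda>h. inner h G)) (at (m x) within {\<mu> \<in> pmfs. \<mu> $ s > 0})"
  shows "GDERIV (\<lambda>x. f (m x)) x :> (\<Sum>\<sigma>\<in>UNIV. G $ \<sigma> *\<^sub>R d \<sigma>)"
proof -
  have dm: "(m has_derivative (\<lambda>h. \<chi> \<sigma>. inner h (d \<sigma>))) (at x)"
    using d unfolding gderiv_def
    by (subst has_derivative_componentwise_within) (auto simp: Basis_vec_def inner_axis)
  have "isCont (\<lambda>x. m x $ s) x"
    using d[of s] unfolding gderiv_def by (rule has_derivative_continuous)
  then have "eventually (\<lambda>y. m y $ s > 0) (at x)"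
    using pos by (auto simp: isCont_def intro: order_tendstoD)
  then have "eventually (\<lambda>y. m y $ s > 0) (nhds x)" using pos by (simp add: eventually_nhds_conv_at)
  then obtain S where S: "open S" "x \<in> S" "\<And>y. y \<in> S \<Longrightarrow> m y $ s > 0"
    unfolding eventually_nhds by blast
  have "(f has_derivative (\<lambda>h. inner h G)) (at (m x) within m ` S)"
    by (rule has_derivative_subset[OF f]) (use S m in auto)
  with has_derivative_at_withinI[OF dm]
  have "(f \<circ> m has_derivative (\<lambda>h. inner h G) \<circ> (\<lambda>h. \<chi> \<sigma>. inner h (d \<sigma>))) (at x within S)"
    by (rule diff_chain_within)
  then show ?thesis
    unfolding gderiv_def at_within_open[OF S(2,1)]
    by (simp add: o_def inner_sum_right inner_vec_def[where 'a = real] mult.commute)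
qed

section \<open>Softmax policies\<close>

lemma gderiv_nth: "GDERIV (\<lambda>x :: real ^ 'i. x $ i) x :> axis i 1"
  unfolding gderiv_def
  by (simp add: inner_axis bounded_linear_imp_has_derivative bounded_linear_vec_nth)

lemma softmax_pos: "softmax \<psi> $ a > 0"
  by (auto simp: softmax_def intro!: divide_pos_pos sum_pos)

lemma gderiv_ln_softmax: "GDERIV (\<lambda>\<psi>. ln (softmax \<psi> $ a)) \<psi> :> axis a 1 - softmax \<psi>"
proof -
  let ?Z = "\<lambda>\<psi> :: real ^ 'a. \<Sum>b\<in>UNIV. exp (\<psi> $ b)"
  have Z: "?Z \<psi> > 0" for \<psi> :: "real ^ 'a" by (auto intro!: sum_pos)
  have "GDERIV (\<lambda>\<psi>. exp (\<psi> $ b)) \<psi> :> exp (\<psi> $ b) *\<^sub>R axis b 1" for b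
    by (rule GDERIV_DERIV_compose[OF gderiv_nth DERIV_exp])
  then have "GDERIV ?Z \<psi> :> (\<Sum>b\<in>UNIV. exp (\<psi> $ b) *\<^sub>R axis b 1)"
    by (rule gderiv_sum)
  then have "GDERIV (\<lambda>\<psi>. ln (?Z \<psi>)) \<psi> :> inverse (?Z \<psi>) *\<^sub>R (\<Sum>b\<in>UNIV. exp (\<psi> $ b) *\<^sub>R axis b 1)"
    by (rule GDERIV_DERIV_compose) (use DERIV_ln[OF Z[of \<psi>]] in simp)
  moreover have "inverse (?Z \<psi>) *\<^sub>R (\<Sum>b\<in>UNIV. exp (\<psi> $ b) *\<^sub>R axis b 1) = softmax \<psi>"
    by (simp add: vec_eq_iff softmax_def axis_def sum_component if_distrib if_distribR divide_inverse
        mult.commute cong: if_cong)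
  ultimately have "GDERIV (\<lambda>\<psi>. \<psi> $ a - ln (?Z \<psi>)) \<psi> :> axis a 1 - softmax \<psi>"
    using GDERIV_diff[OF gderiv_nth] by metis
  moreover have "ln (softmax \<psi> $ a) = \<psi> $ a - ln (?Z \<psi>)" for \<psi> :: "real ^ 'a"
    using Z[of \<psi>] by (simp add: softmax_def ln_div)
  ultimately show ?thesis by simp
qed

lemma gderiv_softmax: "GDERIV (\<lambda>\<psi>. softmax \<psi> $ a) \<psi> :> softmax \<psi> $ a *\<^sub>R (axis a 1 - softmax \<psi>)"
proof -
  have "GDERIV (\<lambda>\<psi>. exp (ln (softmax \<psi> $ a))) \<psi> :>
      exp (ln (softmax \<psi> $ a)) *\<^sub>R (axis a 1 - softmax \<psi>)"
    by (rule GDERIV_DERIV_compose[OF gderiv_ln_softmax DERIV_exp])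
  then show ?thesis by (simp add: softmax_pos)
qed

lemma softmax_fisher_nth:
  "softmax_fisher \<psi> $ b $ c = (\<Sum>a\<in>UNIV. softmax \<psi> $ a *
     ((if b = a then 1 else 0) - softmax \<psi> $ b) * ((if c = a then 1 else 0) - softmax \<psi> $ c))"
  by (simp add: softmax_fisher_def gradient_eqI[OF gderiv_ln_softmax] outer_def sum_component
      axis_def mult.assoc)

text \<open>The Fisher matrix of a softmax policy \<open>p\<close> is \<open>diag p - p p\<^sup>T\<close>, which is also the Jacobian of the
  softmax map.\<close>

lemma softmax_fisher_eq:
  "softmax_fisher \<psi> $ b $ c = softmax \<psi> $ b * ((if b = c then 1 else 0) - softmax \<psi> $ c)"
proof -
  let ?p = "softmax \<psi>"
  have 1: "(\<Sum>a\<in>UNIV. ?p $ a) = 1" using softmax_pmfs[of \<psi>] by (simp add: pmfs_def)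
  have "softmax_fisher \<psi> $ b $ c = (\<Sum>a\<in>UNIV. (if b = a then if c = a then ?p $ a else 0 else 0) -
      (if b = a then ?p $ a * ?p $ c else 0) - (if c = a then ?p $ a * ?p $ b else 0) +
      ?p $ a * (?p $ b * ?p $ c))"
    unfolding softmax_fisher_nth by (intro sum.cong) (auto simp: algebra_simps)
  also have "\<dots> = ?p $ b * ((if b = c then 1 else 0) - ?p $ c)"
    by (simp add: sum.distrib sum_subtractf 1 algebra_simps flip: sum_distrib_right)
  finally show ?thesis .
qed

text \<open>The adjoint of \<open>block\<close>: it turns a gradient in one block into a gradient in the whole parameter.\<close>

definition embed_block :: "nat \<Rightarrow> 'z \<Rightarrow> real ^ 'a::finite \<Rightarrow> ('t::finite, 'z::finite, 'a) param" where
  "embed_block t z d = (\<chi> k. case k of (i, z', b) \<Rightarrow>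
     if i = from_nat_into UNIV t \<and> z' = z then d $ b else 0)"

definition policy_score ::
    "('t::finite, 'z::finite, 'a::finite) param \<Rightarrow> nat \<Rightarrow> 'z \<Rightarrow> 'a \<Rightarrow> ('t, 'z, 'a) param" where
  "policy_score \<gamma> t z a = embed_block t z (axis a 1 - policy \<gamma> t z)"

lemma inner_embed_block: "inner h (embed_block t z d) = inner (block h t z) d"
proof -
  have "inner h (embed_block t z d) =
      (\<Sum>k\<in>range (\<lambda>b. (from_nat_into UNIV t, z, b)). h $ k * embed_block t z d $ k)"
    unfolding inner_vec_def by (intro sum.mono_neutral_cong_right) (auto simp: embed_block_def split: if_splits)
  also have "\<dots> = (\<Sum>b\<in>UNIV. h $ (from_nat_into UNIV t, z, b) * d $ b)"
    by (subst sum.reindex) (auto simp: inj_on_def embed_block_def)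
  finally show ?thesis by (simp add: inner_vec_def block_def)
qed

lemma gderiv_block:
  fixes \<gamma> :: "('t::finite, 'z::finite, 'a::finite) param"
  assumes "GDERIV f (block \<gamma> t z) :> d"
  shows "GDERIV (\<lambda>\<gamma>. f (block \<gamma> t z)) \<gamma> :> embed_block t z d"
proof -
  have "linear (\<lambda>\<gamma> :: ('t, 'z, 'a) param. block \<gamma> t z)"
    by (rule linearI) (auto simp: block_def vec_eq_iff)
  then have block: "((\<lambda>\<gamma>. block \<gamma> t z) has_derivative (\<lambda>\<gamma>. block \<gamma> t z)) (at \<gamma>)"
    by (intro bounded_linear_imp_has_derivative linear_conv_bounded_linear[THEN iffD1])
  then show ?thesis
    using diff_chain_at[OF block assms[unfolded gderiv_def]]
    unfolding gderiv_def inner_embed_block by (simp add: o_def)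
qed

lemma embed_block_scaleR: "embed_block t z (c *\<^sub>R d) = c *\<^sub>R embed_block t z d"
  by (auto simp: embed_block_def vec_eq_iff)

lemma gderiv_policy:
  "GDERIV (\<lambda>\<gamma>. policy \<gamma> t z $ a) \<gamma> :> policy \<gamma> t z $ a *\<^sub>R policy_score \<gamma> t z a"
  using gderiv_block[OF gderiv_softmax[of a "block \<gamma> t z"]]
  by (simp add: policy_score_def policy_def embed_block_scaleR)

lemma policy_pmfs: "policy \<gamma> t z \<in> pmfs"
  unfolding policy_def by (rule softmax_pmfs)

lemma policy_pos: "policy \<gamma> t z $ a > 0"
  unfolding policy_def by (rule softmax_pos)

lemma policy_score_mean: "(\<Sum>a\<in>UNIV. policy \<gamma> t z $ a *\<^sub>R policy_score \<gamma> t z a) = 0"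
proof -
  let ?p = "policy \<gamma> t z"
  have 1: "(\<Sum>a\<in>UNIV. ?p $ a) = 1" using policy_pmfs[of \<gamma> t z] by (simp add: pmfs_def)
  have "(\<Sum>a\<in>UNIV. ?p $ a * ((if b = a then 1 else 0) - ?p $ b)) =
      (\<Sum>a\<in>UNIV. (if b = a then ?p $ a else 0) - ?p $ a * ?p $ b)" for b
    by (intro sum.cong) (auto simp: right_diff_distrib)
  then have "(\<Sum>a\<in>UNIV. ?p $ a * ((if b = a then 1 else 0) - ?p $ b)) = 0" for b
    by (simp add: sum_subtractf 1 flip: sum_distrib_right)
  then have "(\<Sum>a\<in>UNIV. ?p $ a *\<^sub>R policy_score \<gamma> t z a) $ (i, z', b) = 0" for i z' b
    by (cases "i = from_nat_into UNIV t \<and> z' = z")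
      (auto simp: sum_component policy_score_def embed_block_def axis_def)
  then show ?thesis by (simp add: vec_eq_iff)
qed

lemma to_nat_on_UNIV:
  "to_nat_on UNIV (i :: 't::finite) < CARD('t)"
  "t < CARD('t) \<Longrightarrow> from_nat_into UNIV t = i \<longleftrightarrow> t = to_nat_on UNIV i"
proof -
  have bij: "bij_betw (to_nat_on UNIV) (UNIV :: 't set) {..<CARD('t)}" by (rule to_nat_on_finite) simp
  then show "to_nat_on UNIV i < CARD('t)" by (auto simp: bij_betw_def)
  assume "t < CARD('t)"
  then have "t \<in> to_nat_on UNIV ` (UNIV :: 't set)" using bij by (auto simp: bij_betw_def)
  then show "from_nat_into UNIV t = i \<longleftrightarrow> t = to_nat_on UNIV i" by auto
qed

text \<open>The gradient of an action probability lies in the range of the approximate Fisher matrix: it is a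
  column of the Jacobian of the softmax map, and the block of the matrix is this Jacobian times the
  mass of the block.\<close>

lemma approx_fisher_policy_score:
  fixes \<gamma> :: "('t::finite, 'z::finite, 'a::finite) param"
  assumes "t < CARD('t)" and mass: "block_mass \<zeta> (state_pmf M \<zeta> \<gamma> t) z \<noteq> 0"
  shows "policy \<gamma> t z $ a *\<^sub>R policy_score \<gamma> t z a =
    approx_fisher M \<zeta> \<gamma> *v axis (from_nat_into UNIV t, z, a) (1 / block_mass \<zeta> (state_pmf M \<zeta> \<gamma> t) z)"
  using assms to_nat_on_UNIV(2)[OF assms(1), of "from_nat_into UNIV t"]
  by (auto simp: vec_eq_iff matrix_vector_mult_def axis_def if_distrib approx_fisher_def
      policy_score_def embed_block_def softmax_fisher_eq policy_def cong: if_cong split: if_splits)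

text \<open>The approximate Fisher matrix is the sum over time of the covariances of the policy scores.\<close>

lemma approx_fisher_eq_sum:
  fixes \<gamma> :: "('t::finite, 'z::finite, 'a::finite) param"
  shows "approx_fisher M \<zeta> \<gamma> $ k $ l = (\<Sum>t<CARD('t). \<Sum>s\<in>UNIV. \<Sum>a\<in>UNIV.
    state_pmf M \<zeta> \<gamma> t $ s * policy \<gamma> t (\<zeta> s) $ a *
    (policy_score \<gamma> t (\<zeta> s) a $ k * policy_score \<gamma> t (\<zeta> s) a $ l))"
proof -
  obtain i z b where k: "k = (i, z, b)" by (cases k)
  obtain i' z' b' where l: "l = (i', z', b')" by (cases l)
  let ?\<tau> = "to_nat_on UNIV i"
  let ?f = "\<lambda>t. \<Sum>s\<in>UNIV. \<Sum>a\<in>UNIV. state_pmf M \<zeta> \<gamma> t $ s * policy \<gamma> t (\<zeta> s) $ a *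
    (policy_score \<gamma> t (\<zeta> s) a $ k * policy_score \<gamma> t (\<zeta> s) a $ l)"
  have \<tau>: "?\<tau> < CARD('t)" by (rule to_nat_on_UNIV)
  have "?f t = (if t = ?\<tau> then ?f ?\<tau> else 0)" if "t < CARD('t)" for t
  proof (cases "t = ?\<tau>")
    case False
    then have "policy_score \<gamma> t (\<zeta> s) a $ k = 0" for s a
      using to_nat_on_UNIV(2)[OF that, of i] by (auto simp: k policy_score_def embed_block_def)
    then show ?thesis using False by simp
  qed simp
  then have "(\<Sum>t<CARD('t). ?f t) = (\<Sum>t<CARD('t). if t = ?\<tau> then ?f ?\<tau> else 0)"
    by (intro sum.cong refl) simp_all
  also have "\<dots> = ?f ?\<tau>" by (subst sum.delta) (simp_all only: finite_lessThan lessThan_iff \<tau> if_True)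
  also have "\<dots> = approx_fisher M \<zeta> \<gamma> $ k $ l"
  proof (cases "i = i' \<and> z = z'")
    case True
    have "(\<Sum>a\<in>UNIV. policy \<gamma> ?\<tau> z $ a *
        (policy_score \<gamma> ?\<tau> z a $ k * policy_score \<gamma> ?\<tau> z a $ l)) =
      softmax_fisher (block \<gamma> ?\<tau> z) $ b $ b'"
      using True by (simp add: k l policy_score_def embed_block_def softmax_fisher_nth axis_def
          policy_def mult.assoc)
    then have "approx_fisher M \<zeta> \<gamma> $ k $ l = (\<Sum>s | \<zeta> s = z. state_pmf M \<zeta> \<gamma> ?\<tau> $ s *
        (\<Sum>a\<in>UNIV. policy \<gamma> ?\<tau> z $ a *
          (policy_score \<gamma> ?\<tau> z a $ k * policy_score \<gamma> ?\<tau> z a $ l)))"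
      using True by (simp add: k l approx_fisher_def block_mass_def sum_distrib_right)
    also have "\<dots> = ?f ?\<tau>"
      by (intro sum.mono_neutral_cong_left)
        (auto simp: sum_distrib_left mult.assoc k policy_score_def embed_block_def)
    finally show ?thesis ..
  next
    case False
    then have "policy_score \<gamma> ?\<tau> (\<zeta> s) a $ k * policy_score \<gamma> ?\<tau> (\<zeta> s) a $ l = 0" for s a
      by (auto simp: k l policy_score_def embed_block_def)
    moreover have "approx_fisher M \<zeta> \<gamma> $ k $ l = 0" using False by (auto simp: k l approx_fisher_def)
    ultimately show ?thesis by (simp only: mult_zero_right sum.neutral_const)
  qed
  finally show ?thesis ..
qed

lemma transpose_approx_fisher: "transpose (approx_fisher M \<zeta> \<gamma>) = approx_fisher M \<zeta> \<gamma>"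
  by (simp add: vec_eq_iff transpose_def approx_fisher_eq_sum mult.commute)

section \<open>The Fisher information of a trajectory\<close>

text \<open>The expectation over trajectories of a time-dependent Markov chain with initial weights \<open>i\<close> and
  step weights \<open>k\<close>. The horizon is a separate argument, in contrast to \<open>trajectories\<close>, to allow induction
  over it.\<close>

definition path_sum :: "('s::finite \<Rightarrow> real) \<Rightarrow> (nat \<Rightarrow> 's \<Rightarrow> 'a::finite \<Rightarrow> 's \<Rightarrow> real) \<Rightarrow> nat \<Rightarrow>
    ((nat \<Rightarrow> 's) \<Rightarrow> (nat \<Rightarrow> 'a) \<Rightarrow> real) \<Rightarrow> real" where
  "path_sum i k T f = (\<Sum>(\<sigma>, \<alpha>)\<in>({..T} \<rightarrow>\<^sub>E UNIV) \<times> ({..<T} \<rightarrow>\<^sub>E UNIV).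
     i (\<sigma> 0) * (\<Prod>t<T. k t (\<sigma> t) (\<alpha> t) (\<sigma> (Suc t))) * f \<sigma> \<alpha>)"

lemma path_sum_add: "path_sum i k T (\<lambda>\<sigma> \<alpha>. f \<sigma> \<alpha> + g \<sigma> \<alpha>) = path_sum i k T f + path_sum i k T g"
  by (simp add: path_sum_def case_prod_unfold distrib_left sum.distrib)

lemma path_sum_0:
  fixes k :: "nat \<Rightarrow> 's::finite \<Rightarrow> 'a::finite \<Rightarrow> 's \<Rightarrow> real"
  shows "path_sum i k 0 (\<lambda>\<sigma> \<alpha>. g (\<sigma> 0)) = (\<Sum>s\<in>UNIV. i s * g s)"
proof -
  have fn: "({0} \<rightarrow>\<^sub>E UNIV) = range (\<lambda>s. \<lambda>t\<in>{0 :: nat}. s :: 's)"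
  proof (intro equalityI subsetI)
    fix \<sigma> :: "nat \<Rightarrow> 's" assume "\<sigma> \<in> {0} \<rightarrow>\<^sub>E UNIV"
    then have "\<sigma> = (\<lambda>t\<in>{0}. \<sigma> 0)" by (auto simp: PiE_def extensional_def)
    then show "\<sigma> \<in> range (\<lambda>s. \<lambda>t\<in>{0}. s)" by blast
  qed (auto split: if_splits)
  have "inj (\<lambda>s. \<lambda>t\<in>{0 :: nat}. s :: 's)" by (auto simp: inj_def dest: fun_cong[of _ _ 0])
  then show ?thesis
    by (simp add: path_sum_def fn sum.reindex flip: sum.cartesian_product)
qed

lemma path_sum_Suc:
  fixes k :: "nat \<Rightarrow> 's::finite \<Rightarrow> 'a::finite \<Rightarrow> 's \<Rightarrow> real"
  shows "path_sum i k (Suc T) f = path_sum i k T (\<lambda>\<sigma> \<alpha>. \<Sum>a\<in>UNIV. \<Sum>s'\<in>UNIV.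
     k T (\<sigma> T) a s' * f (\<sigma>(Suc T := s')) (\<alpha>(T := a)))"
proof -
  let ?P = "\<lambda>T. ({..T} \<rightarrow>\<^sub>E (UNIV :: 's set)) \<times> ({..<T} \<rightarrow>\<^sub>E (UNIV :: 'a set))"
  let ?w = "\<lambda>T \<sigma> \<alpha>. i (\<sigma> 0) * (\<Prod>t<T. k t (\<sigma> t) (\<alpha> t) (\<sigma> (Suc t)))"
  have prod: "(\<Prod>t<T. k t ((\<sigma>(Suc T := s')) t) ((\<alpha>(T := a)) t) ((\<sigma>(Suc T := s')) (Suc t))) =
      (\<Prod>t<T. k t (\<sigma> t) (\<alpha> t) (\<sigma> (Suc t)))" for \<sigma> \<alpha> s' a
    by (intro prod.cong) auto
  have ext\<sigma>: "(restrict \<sigma> {..T})(Suc T := \<sigma> (Suc T)) = \<sigma>" if "\<sigma> \<in> {..Suc T} \<rightarrow>\<^sub>E (UNIV :: 's set)" for \<sigma>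
    using that by (auto simp: PiE_iff extensional_def fun_eq_iff le_Suc_eq)
  have ext\<alpha>: "(restrict \<alpha> {..<T})(T := \<alpha> T) = \<alpha>" if "\<alpha> \<in> {..<Suc T} \<rightarrow>\<^sub>E (UNIV :: 'a set)" for \<alpha>
    using that by (auto simp: PiE_iff extensional_def fun_eq_iff less_Suc_eq)
  have restr\<sigma>: "restrict (\<sigma>(Suc T := s')) {..T} = \<sigma>" if "\<sigma> \<in> {..T} \<rightarrow>\<^sub>E (UNIV :: 's set)" for \<sigma> s'
    using that by (auto simp: PiE_iff extensional_def fun_eq_iff)
  have restr\<alpha>: "restrict (\<alpha>(T := a)) {..<T} = \<alpha>" if "\<alpha> \<in> {..<T} \<rightarrow>\<^sub>E (UNIV :: 'a set)" for \<alpha> a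
    using that by (auto simp: PiE_iff extensional_def fun_eq_iff)
  have "path_sum i k (Suc T) f = (\<Sum>((\<sigma>, \<alpha>), (a, s'))\<in>?P T \<times> (UNIV \<times> UNIV).
      ?w (Suc T) (\<sigma>(Suc T := s')) (\<alpha>(T := a)) * f (\<sigma>(Suc T := s')) (\<alpha>(T := a)))"
    unfolding path_sum_def
  proof (rule sum.reindex_bij_witness[of _ "\<lambda>((\<sigma>, \<alpha>), (a, s')). (\<sigma>(Suc T := s'), \<alpha>(T := a))"
        "\<lambda>(\<sigma>, \<alpha>). ((restrict \<sigma> {..T}, restrict \<alpha> {..<T}), (\<alpha> T, \<sigma> (Suc T)))"], goal_cases)
    case (1 x)
    then show ?case using ext\<sigma> ext\<alpha> by (auto simp del: restrict_fupd)
  next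
    case (2 x)
    then show ?case by auto
  next
    case (3 y)
    then show ?case using restr\<sigma> restr\<alpha> by auto
  next
    case (4 y)
    then show ?case by (auto simp: atMost_Suc lessThan_Suc intro!: PiE_fun_upd)
  next
    case (5 x)
    then obtain \<sigma> \<alpha> where "x = (\<sigma>, \<alpha>)" "\<sigma> \<in> {..Suc T} \<rightarrow>\<^sub>E UNIV" "\<alpha> \<in> {..<Suc T} \<rightarrow>\<^sub>E UNIV" by auto
    then show ?case by (simp only: case_prod_conv ext\<sigma> ext\<alpha>)
  qed
  also have "\<dots> = (\<Sum>((\<sigma>, \<alpha>), (a, s'))\<in>?P T \<times> (UNIV \<times> UNIV).
      ?w T \<sigma> \<alpha> * (k T (\<sigma> T) a s' * f (\<sigma>(Suc T := s')) (\<alpha>(T := a))))"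
  proof (intro sum.cong refl, clarify)
    fix \<sigma> \<alpha> a s'
    show "?w (Suc T) (\<sigma>(Suc T := s')) (\<alpha>(T := a)) * f (\<sigma>(Suc T := s')) (\<alpha>(T := a)) =
      ?w T \<sigma> \<alpha> * (k T (\<sigma> T) a s' * f (\<sigma>(Suc T := s')) (\<alpha>(T := a)))"
      unfolding prod.lessThan_Suc prod by simp
  qed
  also have "\<dots> = path_sum i k T (\<lambda>\<sigma> \<alpha>. \<Sum>a\<in>UNIV. \<Sum>s'\<in>UNIV.
     k T (\<sigma> T) a s' * f (\<sigma>(Suc T := s')) (\<alpha>(T := a)))"
    unfolding path_sum_def
    by (subst sum.cartesian_product[symmetric], intro sum.cong refl, clarify)
      (simp add: sum_distrib_left sum.cartesian_product[symmetric] del: UNIV_Times_UNIV)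
  finally show ?thesis .
qed

lemma path_sum_state:
  fixes k :: "nat \<Rightarrow> 's::finite \<Rightarrow> 'a::finite \<Rightarrow> 's \<Rightarrow> real"
  assumes "\<And>s. m 0 s = i s"
    and "\<And>t s'. t < T \<Longrightarrow> m (Suc t) s' = (\<Sum>s\<in>UNIV. \<Sum>a\<in>UNIV. m t s * k t s a s')"
  shows "path_sum i k T (\<lambda>\<sigma> \<alpha>. g (\<sigma> T)) = (\<Sum>s\<in>UNIV. m T s * g s)"
  using assms(2)
proof (induction T arbitrary: g)
  case 0
  then show ?case by (simp add: path_sum_0 assms(1))
next
  case (Suc T)
  have "path_sum i k (Suc T) (\<lambda>\<sigma> \<alpha>. g (\<sigma> (Suc T))) =
      path_sum i k T (\<lambda>\<sigma> \<alpha>. \<Sum>a\<in>UNIV. \<Sum>s'\<in>UNIV. k T (\<sigma> T) a s' * g s')"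
    by (simp add: path_sum_Suc)
  also have "\<dots> = (\<Sum>s\<in>UNIV. m T s * (\<Sum>a\<in>UNIV. \<Sum>s'\<in>UNIV. k T s a s' * g s'))"
    by (rule Suc.IH) (use Suc.prems in auto)
  also have "\<dots> = (\<Sum>s\<in>UNIV. \<Sum>a\<in>UNIV. \<Sum>s'\<in>UNIV. m T s * k T s a s' * g s')"
    by (simp add: sum_distrib_left mult.assoc)
  also have "\<dots> = (\<Sum>s\<in>UNIV. \<Sum>s'\<in>UNIV. \<Sum>a\<in>UNIV. m T s * k T s a s' * g s')"
    by (intro sum.cong refl sum.swap)
  also have "\<dots> = (\<Sum>s'\<in>UNIV. \<Sum>s\<in>UNIV. \<Sum>a\<in>UNIV. m T s * k T s a s' * g s')"
    by (rule sum.swap)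
  also have "\<dots> = (\<Sum>s'\<in>UNIV. m (Suc T) s' * g s')"
    using Suc.prems[of T] by (simp add: sum_distrib_right)
  finally show ?case .
qed

text \<open>Martingale differences at different times are uncorrelated: in the induction over the horizon the
  last increments have mean zero given the past, so that only their own covariance is added.\<close>

lemma path_sum_martingale_covariance:
  fixes k :: "nat \<Rightarrow> 's::finite \<Rightarrow> 'a::finite \<Rightarrow> 's \<Rightarrow> real"
  assumes m0: "\<And>s. m 0 s = i s"
    and mS: "\<And>t s'. t < T \<Longrightarrow> m (Suc t) s' = (\<Sum>s\<in>UNIV. \<Sum>a\<in>UNIV. m t s * k t s a s')"
    and one: "\<And>t s. t < T \<Longrightarrow> (\<Sum>a\<in>UNIV. \<Sum>s'\<in>UNIV. k t s a s') = 1"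
    and \<xi>: "\<And>t s. t < T \<Longrightarrow> (\<Sum>a\<in>UNIV. \<Sum>s'\<in>UNIV. k t s a s' * \<xi> t s a s') = 0"
    and \<eta>: "\<And>t s. t < T \<Longrightarrow> (\<Sum>a\<in>UNIV. \<Sum>s'\<in>UNIV. k t s a s' * \<eta> t s a s') = 0"
  shows "path_sum i k T (\<lambda>\<sigma> \<alpha>. (\<Sum>t<T. \<xi> t (\<sigma> t) (\<alpha> t) (\<sigma> (Suc t))) *
      (\<Sum>t<T. \<eta> t (\<sigma> t) (\<alpha> t) (\<sigma> (Suc t)))) =
    (\<Sum>t<T. \<Sum>s\<in>UNIV. m t s * (\<Sum>a\<in>UNIV. \<Sum>s'\<in>UNIV. k t s a s' * (\<xi> t s a s' * \<eta> t s a s')))"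
  using mS one \<xi> \<eta>
proof (induction T)
  case 0
  then show ?case by (simp add: path_sum_def case_prod_unfold)
next
  case (Suc T)
  define X where "X = (\<lambda>(\<sigma> :: nat \<Rightarrow> 's) (\<alpha> :: nat \<Rightarrow> 'a). \<Sum>t<T. \<xi> t (\<sigma> t) (\<alpha> t) (\<sigma> (Suc t)))"
  define Y where "Y = (\<lambda>(\<sigma> :: nat \<Rightarrow> 's) (\<alpha> :: nat \<Rightarrow> 'a). \<Sum>t<T. \<eta> t (\<sigma> t) (\<alpha> t) (\<sigma> (Suc t)))"
  define V where "V = (\<lambda>s. \<Sum>a\<in>UNIV. \<Sum>s'\<in>UNIV. k T s a s' * (\<xi> T s a s' * \<eta> T s a s'))"
  have upd: "(\<Sum>t<Suc T. f t ((\<sigma>(Suc T := s')) t) ((\<alpha>(T := a)) t) ((\<sigma>(Suc T := s')) (Suc t))) =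
      (\<Sum>t<T. f t (\<sigma> t) (\<alpha> t) (\<sigma> (Suc t))) + f T (\<sigma> T) a s'"
    for f :: "nat \<Rightarrow> 's \<Rightarrow> 'a \<Rightarrow> 's \<Rightarrow> real" and \<sigma> \<alpha> a s'
    by (auto intro!: sum.cong)
  have step: "(\<Sum>a\<in>UNIV. \<Sum>s'\<in>UNIV. k T s a s' * ((x + \<xi> T s a s') * (y + \<eta> T s a s'))) = x * y + V s"
    for x y s
  proof -
    have "(\<Sum>a\<in>UNIV. \<Sum>s'\<in>UNIV. k T s a s' * ((x + \<xi> T s a s') * (y + \<eta> T s a s'))) =
        (\<Sum>a\<in>UNIV. \<Sum>s'\<in>UNIV. k T s a s' * (x * y) + k T s a s' * \<eta> T s a s' * x +
          k T s a s' * \<xi> T s a s' * y + k T s a s' * (\<xi> T s a s' * \<eta> T s a s'))"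
      by (intro sum.cong refl) (simp add: algebra_simps)
    also have "\<dots> = x * y + V s"
      using Suc.prems(2-4)[of T s] unfolding V_def sum.distrib sum_distrib_right[symmetric] by simp
    finally show ?thesis .
  qed
  have "path_sum i k (Suc T) (\<lambda>\<sigma> \<alpha>. (\<Sum>t<Suc T. \<xi> t (\<sigma> t) (\<alpha> t) (\<sigma> (Suc t))) *
      (\<Sum>t<Suc T. \<eta> t (\<sigma> t) (\<alpha> t) (\<sigma> (Suc t)))) =
    path_sum i k T (\<lambda>\<sigma> \<alpha>. X \<sigma> \<alpha> * Y \<sigma> \<alpha> + V (\<sigma> T))"
    unfolding path_sum_Suc upd X_def Y_def step ..
  also have "\<dots> = path_sum i k T (\<lambda>\<sigma> \<alpha>. X \<sigma> \<alpha> * Y \<sigma> \<alpha>) + (\<Sum>s\<in>UNIV. m T s * V s)"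
    unfolding path_sum_add
    by (intro arg_cong2[where f = "(+)"] refl path_sum_state m0) (use Suc.prems(1) in auto)
  also have "path_sum i k T (\<lambda>\<sigma> \<alpha>. X \<sigma> \<alpha> * Y \<sigma> \<alpha>) =
    (\<Sum>t<T. \<Sum>s\<in>UNIV. m t s * (\<Sum>a\<in>UNIV. \<Sum>s'\<in>UNIV. k t s a s' * (\<xi> t s a s' * \<eta> t s a s')))"
    unfolding X_def Y_def by (rule Suc.IH) (use Suc.prems in auto)
  finally show ?case by (simp add: V_def)
qed

text \<open>Where the state has no mass or the transition is impossible, the logarithm has no meaningful gradient.
  The value \<open>0\<close> makes \<open>transition_score_mean\<close> hold in all states and lies in the range of every matrix.\<close>

definition transition_score :: "('s::finite, 'a::finite) nmdp \<Rightarrow> ('s \<Rightarrow> 'z::finite)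
    \<Rightarrow> ('t::finite, 'z, 'a) param \<Rightarrow> nat \<Rightarrow> 's \<Rightarrow> 'a \<Rightarrow> 's \<Rightarrow> ('t, 'z, 'a) param" where
  "transition_score M \<zeta> \<gamma> t s a s' =
     (if state_pmf M \<zeta> \<gamma> t $ s > 0 \<and> transition M t (state_pmf M \<zeta> \<gamma> t) s a $ s' > 0
      then gradient (\<lambda>\<gamma>. ln (transition M t (state_pmf M \<zeta> \<gamma> t) s a $ s')) \<gamma> else 0)"

context
  fixes M :: "('s::finite, 'a::finite) nmdp" and \<zeta> :: "'s \<Rightarrow> 'z::finite"
  assumes mdp: "nonlinear_mdp M"
begin

lemma transition_pmfs:
  fixes \<gamma> :: "('t::finite, 'z, 'a) param"
  assumes "t < horizon M"
  shows "transition M t (state_pmf M \<zeta> \<gamma> t) s a \<in> pmfs"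
proof -
  have "state_pmf M \<zeta> \<gamma> t \<in> pmfs" using assms by (intro state_pmf_pmfs[OF mdp]) simp
  then show ?thesis using mdp assms by (simp add: nonlinear_mdp_def)
qed

text \<open>For a possible transition this is the derivative of a logarithm; an impossible one is at a minimum of
  its probability, so the gradient is zero.\<close>

lemma gderiv_transition:
  fixes \<gamma> :: "('t::finite, 'z, 'a) param"
  assumes t: "t < horizon M" and s: "state_pmf M \<zeta> \<gamma> t $ s > 0"
  shows "GDERIV (\<lambda>\<gamma>. transition M t (state_pmf M \<zeta> \<gamma> t) s a $ s') \<gamma> :>
    transition M t (state_pmf M \<zeta> \<gamma> t) s a $ s' *\<^sub>R transition_score M \<zeta> \<gamma> t s a s'"
proof -
  let ?p = "\<lambda>\<gamma> :: ('t, 'z, 'a) param. transition M t (state_pmf M \<zeta> \<gamma> t) s a $ s'"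
  have m: "state_pmf M \<zeta> \<gamma> t \<in> pmfs" for \<gamma> :: "('t, 'z, 'a) param"
    using t by (intro state_pmf_pmfs[OF mdp]) simp
  have "\<exists>d. GDERIV (\<lambda>\<gamma>. state_pmf M \<zeta> \<gamma> t $ \<sigma>) \<gamma> :> d" for \<sigma>
    using state_pmf_differentiable[OF mdp, of t \<zeta> \<sigma> \<gamma>] t differentiable_imp_gderiv by (metis less_imp_le)
  then obtain d where d: "\<And>\<sigma>. GDERIV (\<lambda>\<gamma>. state_pmf M \<zeta> \<gamma> t $ \<sigma>) \<gamma> :> d \<sigma>" by metis
  have "smooth_extension {\<mu> \<in> pmfs. \<mu> $ s > 0} (\<lambda>\<mu>. transition M t \<mu> s a $ s')"
    using mdp t by (simp add: nonlinear_mdp_def)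
  then obtain G where "\<And>\<mu>. \<mu> \<in> {\<mu> \<in> pmfs. \<mu> $ s > 0} \<Longrightarrow>
      ((\<lambda>\<mu>. transition M t \<mu> s a $ s') has_derivative (\<lambda>h. inner h (G \<mu>)))
        (at \<mu> within {\<mu> \<in> pmfs. \<mu> $ s > 0})"
    by (rule smooth_extension_gradient[OF _ convex_positive_pmfs]) blast
  then have "((\<lambda>\<mu>. transition M t \<mu> s a $ s') has_derivative
      (\<lambda>h. inner h (G (state_pmf M \<zeta> \<gamma> t)))) (at (state_pmf M \<zeta> \<gamma> t) within {\<mu> \<in> pmfs. \<mu> $ s > 0})"
    using m s by simp
  then obtain D where D: "GDERIV ?p \<gamma> :> D"
    using gderiv_smooth_compose[where m = "\<lambda>\<gamma>. state_pmf M \<zeta> \<gamma> t", OF m s d] by blast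
  show ?thesis
  proof (cases "?p \<gamma> > 0")
    case True
    have "GDERIV (\<lambda>\<gamma>. ln (?p \<gamma>)) \<gamma> :> inverse (?p \<gamma>) *\<^sub>R D"
      using True by (intro GDERIV_DERIV_compose[OF D]) (auto intro!: derivative_eq_intros simp: field_simps)
    then have "transition_score M \<zeta> \<gamma> t s a s' = inverse (?p \<gamma>) *\<^sub>R D"
      using True s by (simp add: transition_score_def gradient_eqI)
    then show ?thesis using D True by simp
  next
    case False
    have "0 \<le> ?p \<gamma>" for \<gamma> using pmfs_ge_0[OF transition_pmfs[OF t]] .
    then have "?p \<gamma> = 0" "D = 0" using False gderiv_min_zero[OF D] by (auto simp: not_less antisym)
    then show ?thesis using D by simp
  qed
qed

text \<open>The scores of the transitions are martingale differences too, because the probabilities of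
  the successors sum to one identically in the parameter.\<close>

lemma transition_score_mean:
  fixes \<gamma> :: "('t::finite, 'z, 'a) param"
  assumes t: "t < horizon M"
  shows "(\<Sum>s'\<in>UNIV. transition M t (state_pmf M \<zeta> \<gamma> t) s a $ s' *\<^sub>R transition_score M \<zeta> \<gamma> t s a s') = 0"
proof (cases "state_pmf M \<zeta> \<gamma> t $ s > 0")
  case True
  let ?p = "\<lambda>\<gamma> :: ('t, 'z, 'a) param. \<lambda>s'. transition M t (state_pmf M \<zeta> \<gamma> t) s a $ s'"
  have "GDERIV (\<lambda>\<gamma>. \<Sum>s'\<in>UNIV. ?p \<gamma> s') \<gamma> :> (\<Sum>s'\<in>UNIV. ?p \<gamma> s' *\<^sub>R transition_score M \<zeta> \<gamma> t s a s')"
    by (intro gderiv_sum gderiv_transition t True)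
  moreover have "(\<lambda>\<gamma>. \<Sum>s'\<in>UNIV. ?p \<gamma> s') = (\<lambda>_. 1)"
    using transition_pmfs[OF t] by (auto simp: pmfs_def)
  ultimately have "GDERIV (\<lambda>_. 1) \<gamma> :> (\<Sum>s'\<in>UNIV. ?p \<gamma> s' *\<^sub>R transition_score M \<zeta> \<gamma> t s a s')" by simp
  from gradient_eqI[OF this] gradient_eqI[OF GDERIV_const, of "1 :: real" \<gamma>] show ?thesis by simp
qed (simp add: transition_score_def)

lemma state_pmf_pos_Suc:
  fixes \<gamma> :: "('t::finite, 'z, 'a) param"
  assumes t: "t < horizon M" and s: "state_pmf M \<zeta> \<gamma> t $ s > 0"
    and p: "transition M t (state_pmf M \<zeta> \<gamma> t) s a $ s' > 0"
  shows "state_pmf M \<zeta> \<gamma> (Suc t) $ s' > 0"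
proof -
  let ?f = "\<lambda>s a. state_pmf M \<zeta> \<gamma> t $ s * policy \<gamma> t (\<zeta> s) $ a * transition M t (state_pmf M \<zeta> \<gamma> t) s a $ s'"
  have nonneg: "0 \<le> ?f s a" for s a
    using t pmfs_ge_0[OF state_pmf_pmfs[OF mdp, of t \<zeta> \<gamma>]] pmfs_ge_0[OF transition_pmfs[OF t]]
      policy_pos[of \<gamma> t "\<zeta> s" a] by (auto intro!: mult_nonneg_nonneg simp: less_imp_le)
  have "0 < ?f s a" using s p policy_pos by (intro mult_pos_pos)
  also have "\<dots> \<le> (\<Sum>a\<in>UNIV. ?f s a)" by (rule member_le_sum) (auto simp: nonneg)
  also have "\<dots> \<le> (\<Sum>s\<in>UNIV. \<Sum>a\<in>UNIV. ?f s a)"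
    by (rule member_le_sum[of s UNIV "\<lambda>s. \<Sum>a\<in>UNIV. ?f s a"]) (auto intro!: sum_nonneg nonneg)
  finally show ?thesis by simp
qed

lemma trajectory_pmf_nonneg:
  fixes \<gamma> :: "('t::finite, 'z, 'a) param"
  shows "0 \<le> trajectory_pmf M \<zeta> \<gamma> \<tau>"
proof -
  have "init_pmf M \<in> pmfs" using mdp by (simp add: nonlinear_mdp_def)
  then show ?thesis
    unfolding trajectory_pmf_def using policy_pos[of \<gamma>]
    by (auto simp: case_prod_unfold less_imp_le intro!: mult_nonneg_nonneg prod_nonneg pmfs_ge_0 transition_pmfs policy_pmfs)
qed

lemma trajectory_score:
  fixes \<gamma> :: "('t::finite, 'z, 'a) param"
  assumes pos: "trajectory_pmf M \<zeta> \<gamma> (\<sigma>, \<alpha>) > 0"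
  shows "gradient (\<lambda>\<gamma>. ln (trajectory_pmf M \<zeta> \<gamma> (\<sigma>, \<alpha>))) \<gamma> =
    (\<Sum>t<horizon M. policy_score \<gamma> t (\<zeta> (\<sigma> t)) (\<alpha> t) +
       transition_score M \<zeta> \<gamma> t (\<sigma> t) (\<alpha> t) (\<sigma> (Suc t)))"
proof -
  let ?p = "\<lambda>t (\<gamma> :: ('t, 'z, 'a) param). transition M t (state_pmf M \<zeta> \<gamma> t) (\<sigma> t) (\<alpha> t) $ \<sigma> (Suc t)"
  let ?\<pi> = "\<lambda>t (\<gamma> :: ('t, 'z, 'a) param). policy \<gamma> t (\<zeta> (\<sigma> t)) $ \<alpha> t"
  let ?score = "\<lambda>t. policy_score \<gamma> t (\<zeta> (\<sigma> t)) (\<alpha> t) + transition_score M \<zeta> \<gamma> t (\<sigma> t) (\<alpha> t) (\<sigma> (Suc t))"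
  have "init_pmf M $ \<sigma> 0 * (\<Prod>t<horizon M. ?\<pi> t \<gamma> * ?p t \<gamma>) \<noteq> 0"
    using pos by (simp only: trajectory_pmf_def case_prod_conv less_imp_neq[symmetric] not_False_eq_True)
  then have nz: "init_pmf M $ \<sigma> 0 \<noteq> 0" "\<And>t. t < horizon M \<Longrightarrow> ?p t \<gamma> \<noteq> 0"
    by (simp_all only: mult_eq_0_iff prod_zero_iff[OF finite_lessThan] de_Morgan_disj lessThan_iff) blast+
  have p: "?p t \<gamma> > 0" if "t < horizon M" for t
    using nz(2)[OF that] pmfs_ge_0[OF transition_pmfs[OF that]] by (metis order_le_less)
  have m: "state_pmf M \<zeta> \<gamma> t $ \<sigma> t > 0" if "t \<le> horizon M" for t
    using that
  proof (induction t)
    case 0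
    have "init_pmf M \<in> pmfs" using mdp by (simp add: nonlinear_mdp_def)
    then show ?case using nz(1) pmfs_ge_0[of "init_pmf M" "\<sigma> 0"] by simp
  next
    case (Suc t)
    then show ?case using p[of t] by (intro state_pmf_pos_Suc[of t _ "\<sigma> t" "\<alpha> t"]) auto
  qed
  have "GDERIV (\<lambda>\<gamma>. ?\<pi> t \<gamma> * ?p t \<gamma>) \<gamma> :> (?\<pi> t \<gamma> * ?p t \<gamma>) *\<^sub>R ?score t" if t: "t < horizon M" for t
    using GDERIV_mult[OF gderiv_policy gderiv_transition[OF t m[OF less_imp_le[OF t]]], of t "\<zeta> (\<sigma> t)" "\<alpha> t" "\<alpha> t" "\<sigma> (Suc t)"]
    by (simp add: scaleR_right_distrib mult.commute add.commute)
  then have prod: "GDERIV (\<lambda>\<gamma>. \<Prod>t<horizon M. ?\<pi> t \<gamma> * ?p t \<gamma>) \<gamma> :>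
      (\<Prod>t<horizon M. ?\<pi> t \<gamma> * ?p t \<gamma>) *\<^sub>R (\<Sum>t<horizon M. ?score t)"
    by (intro gderiv_prod_log) auto
  have q: "GDERIV (\<lambda>\<gamma>. trajectory_pmf M \<zeta> \<gamma> (\<sigma>, \<alpha>)) \<gamma> :>
      trajectory_pmf M \<zeta> \<gamma> (\<sigma>, \<alpha>) *\<^sub>R (\<Sum>t<horizon M. ?score t)"
    using GDERIV_mult[OF GDERIV_const[of "init_pmf M $ \<sigma> 0"] prod]
    by (simp add: trajectory_pmf_def mult.commute)
  have "GDERIV (\<lambda>\<gamma>. ln (trajectory_pmf M \<zeta> \<gamma> (\<sigma>, \<alpha>))) \<gamma> :>
      inverse (trajectory_pmf M \<zeta> \<gamma> (\<sigma>, \<alpha>)) *\<^sub>R trajectory_pmf M \<zeta> \<gamma> (\<sigma>, \<alpha>) *\<^sub>R (\<Sum>t<horizon M. ?score t)"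
    using pos by (intro GDERIV_DERIV_compose[OF q]) (auto intro!: derivative_eq_intros simp: field_simps)
  then show ?thesis using pos by (simp add: gradient_eqI)
qed

text \<open>The policy scores have mean zero given the state, and the transition scores have mean zero given
  the state and the action. So the two are uncorrelated at equal times, and their sum is a martingale
  difference.\<close>

lemma fisher_nth:
  fixes \<gamma> :: "('t::finite, 'z, 'a) param"
  assumes T: "horizon M = CARD('t)"
  shows "fisher M \<zeta> \<gamma> $ k $ l = approx_fisher M \<zeta> \<gamma> $ k $ l +
    (\<Sum>t<horizon M. \<Sum>s\<in>UNIV. \<Sum>a\<in>UNIV. \<Sum>s'\<in>UNIV. state_pmf M \<zeta> \<gamma> t $ s * policy \<gamma> t (\<zeta> s) $ a *
       transition M t (state_pmf M \<zeta> \<gamma> t) s a $ s' *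
       (transition_score M \<zeta> \<gamma> t s a s' $ k * transition_score M \<zeta> \<gamma> t s a s' $ l))"
proof -
  define m where "m t s = state_pmf M \<zeta> \<gamma> t $ s" for t s
  define \<pi> where "\<pi> t s a = policy \<gamma> t (\<zeta> s) $ a" for t s a
  define p where "p t s a s' = transition M t (state_pmf M \<zeta> \<gamma> t) s a $ s'" for t s a s'
  define u where "u c t s a = policy_score \<gamma> t (\<zeta> s) a $ c" for c t s a
  define w where "w c t s a s' = transition_score M \<zeta> \<gamma> t s a s' $ c" for c t s a s'
  have sp: "(\<Sum>s'\<in>UNIV. p t s a s') = 1" if "t < horizon M" for t s a
    using transition_pmfs[OF that, where \<gamma> = \<gamma>] by (simp add: p_def pmfs_def)
  have s\<pi>: "(\<Sum>a\<in>UNIV. \<pi> t s a) = 1" for t s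
    using policy_pmfs[of \<gamma> t "\<zeta> s"] by (simp add: \<pi>_def pmfs_def)
  have u0: "(\<Sum>a\<in>UNIV. \<pi> t s a * u c t s a) = 0" for c t s
    using arg_cong[OF policy_score_mean[of \<gamma> t "\<zeta> s"], of "\<lambda>v. v $ c"]
    by (simp add: \<pi>_def u_def sum_component)
  have w0: "(\<Sum>s'\<in>UNIV. p t s a s' * w c t s a s') = 0" if "t < horizon M" for c t s a
    using arg_cong[OF transition_score_mean[OF that, of \<gamma> s a], of "\<lambda>v. v $ c"]
    by (simp add: p_def w_def sum_component)
  have split: "(\<Sum>s'\<in>UNIV. \<pi> t s a * p t s a s' * f s') = \<pi> t s a * (\<Sum>s'\<in>UNIV. p t s a s' * f s')"
    for t s a and f :: "'s \<Rightarrow> real"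
    by (simp add: sum_distrib_left mult.assoc)
  have mean: "(\<Sum>a\<in>UNIV. \<Sum>s'\<in>UNIV. \<pi> t s a * p t s a s' * (u c t s a + w c t s a s')) = 0"
    if t: "t < horizon M" for c t s
  proof -
    have "(\<Sum>s'\<in>UNIV. p t s a s' * (u c t s a + w c t s a s')) = u c t s a" for a
      by (simp add: distrib_left sum.distrib w0[OF t] sp[OF t] flip: sum_distrib_right)
    then show ?thesis by (simp only: split u0)
  qed
  have cov: "(\<Sum>a\<in>UNIV. \<Sum>s'\<in>UNIV. \<pi> t s a * p t s a s' *
        ((u k t s a + w k t s a s') * (u l t s a + w l t s a s'))) =
      (\<Sum>a\<in>UNIV. \<pi> t s a * (u k t s a * u l t s a)) +
      (\<Sum>a\<in>UNIV. \<Sum>s'\<in>UNIV. \<pi> t s a * p t s a s' * (w k t s a s' * w l t s a s'))"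
    if t: "t < horizon M" for t s
  proof -
    have "(\<Sum>s'\<in>UNIV. p t s a s' * ((u k t s a + w k t s a s') * (u l t s a + w l t s a s'))) =
       u k t s a * u l t s a + (\<Sum>s'\<in>UNIV. p t s a s' * (w k t s a s' * w l t s a s'))" for a
    proof -
      have "(\<Sum>s'\<in>UNIV. p t s a s' * ((u k t s a + w k t s a s') * (u l t s a + w l t s a s'))) =
        (\<Sum>s'\<in>UNIV. p t s a s' * (u k t s a * u l t s a) + p t s a s' * w l t s a s' * u k t s a +
          p t s a s' * w k t s a s' * u l t s a + p t s a s' * (w k t s a s' * w l t s a s'))"
        by (intro sum.cong refl) (simp add: algebra_simps)
      then show ?thesis by (simp add: sum.distrib w0[OF t] sp[OF t] flip: sum_distrib_right)
    qed
    note cond = this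
    show ?thesis unfolding split cond by (simp only: distrib_left sum.distrib)
  qed
  have "fisher M \<zeta> \<gamma> $ k $ l = path_sum (\<lambda>s. init_pmf M $ s) (\<lambda>t s a s'. \<pi> t s a * p t s a s') (horizon M)
    (\<lambda>\<sigma> \<alpha>. (\<Sum>t<horizon M. u k t (\<sigma> t) (\<alpha> t) + w k t (\<sigma> t) (\<alpha> t) (\<sigma> (Suc t))) *
      (\<Sum>t<horizon M. u l t (\<sigma> t) (\<alpha> t) + w l t (\<sigma> t) (\<alpha> t) (\<sigma> (Suc t))))"
    unfolding fisher_def path_sum_def trajectories_def sum_component Let_def
  proof (intro sum.cong refl, clarify)
    fix \<sigma> :: "nat \<Rightarrow> 's" and \<alpha> :: "nat \<Rightarrow> 'a"
    let ?q = "trajectory_pmf M \<zeta> \<gamma> (\<sigma>, \<alpha>)" and ?v = "gradient (\<lambda>\<gamma>. ln (trajectory_pmf M \<zeta> \<gamma> (\<sigma>, \<alpha>))) \<gamma>"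
    have q: "?q = init_pmf M $ \<sigma> 0 * (\<Prod>t<horizon M. \<pi> t (\<sigma> t) (\<alpha> t) * p t (\<sigma> t) (\<alpha> t) (\<sigma> (Suc t)))"
      by (simp add: trajectory_pmf_def \<pi>_def p_def)
    have v: "?v $ c = (\<Sum>t<horizon M. u c t (\<sigma> t) (\<alpha> t) + w c t (\<sigma> t) (\<alpha> t) (\<sigma> (Suc t)))" if "?q > 0" for c
      by (simp add: trajectory_score[OF that] u_def w_def sum_component)
    show "(?q *\<^sub>R outer ?v ?v) $ k $ l = init_pmf M $ \<sigma> 0 *
        (\<Prod>t<horizon M. \<pi> t (\<sigma> t) (\<alpha> t) * p t (\<sigma> t) (\<alpha> t) (\<sigma> (Suc t))) *
        ((\<Sum>t<horizon M. u k t (\<sigma> t) (\<alpha> t) + w k t (\<sigma> t) (\<alpha> t) (\<sigma> (Suc t))) *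
         (\<Sum>t<horizon M. u l t (\<sigma> t) (\<alpha> t) + w l t (\<sigma> t) (\<alpha> t) (\<sigma> (Suc t))))"
      unfolding q[symmetric] using v trajectory_pmf_nonneg[of \<gamma> "(\<sigma>, \<alpha>)"]
      by (cases "?q = 0") (auto simp: outer_def)
  qed
  also have "\<dots> = (\<Sum>t<horizon M. \<Sum>s\<in>UNIV. m t s * (\<Sum>a\<in>UNIV. \<Sum>s'\<in>UNIV. \<pi> t s a * p t s a s' *
      ((u k t s a + w k t s a s') * (u l t s a + w l t s a s'))))"
  proof (rule path_sum_martingale_covariance)
    show "m (Suc t) s' = (\<Sum>s\<in>UNIV. \<Sum>a\<in>UNIV. m t s * (\<pi> t s a * p t s a s'))" for t s'
      by (simp add: m_def \<pi>_def p_def mult.assoc)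
    show "(\<Sum>a\<in>UNIV. \<Sum>s'\<in>UNIV. \<pi> t s a * p t s a s') = 1" if "t < horizon M" for t s
      by (simp add: sp[OF that] s\<pi> flip: sum_distrib_left)
  qed (simp_all add: m_def mean)
  also have "\<dots> = (\<Sum>t<horizon M. \<Sum>s\<in>UNIV. m t s * (\<Sum>a\<in>UNIV. \<pi> t s a * (u k t s a * u l t s a)) +
      m t s * (\<Sum>a\<in>UNIV. \<Sum>s'\<in>UNIV. \<pi> t s a * p t s a s' * (w k t s a s' * w l t s a s')))"
    by (intro sum.cong refl) (subst cov, simp_all only: lessThan_iff distrib_left)
  finally show ?thesis
    by (simp add: sum.distrib approx_fisher_eq_sum T m_def \<pi>_def p_def u_def w_def sum_distrib_left mult.assoc)
qed

end

section \<open>Gradients in the range of the approximate Fisher matrix\<close>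

text \<open>The class, closed under the operations that build the objective, of functions of the parameter whose
  gradients are controlled relative to \<open>A\<close> although \<open>A\<close> degenerates. The values of \<open>f\<close> are
  required to be bounded too, which makes the class closed under products.\<close>

definition gradient_factors :: "(nat \<Rightarrow> real ^ 'k ^ 'k) \<Rightarrow> (nat \<Rightarrow> real ^ 'k) \<Rightarrow> (real ^ 'k \<Rightarrow> real) \<Rightarrow> bool" where
  "gradient_factors A x f \<longleftrightarrow> (\<exists>C. eventually (\<lambda>n. \<bar>f (x n)\<bar> \<le> C \<and>
     (\<exists>y. norm y \<le> C \<and> GDERIV f (x n) :> A n *v y)) sequentially)"

lemma gradient_factors_const: "gradient_factors A x (\<lambda>_. c)"
  unfolding gradient_factors_def
  by (intro exI[of _ "\<bar>c\<bar>"] always_eventually allI conjI exI[of _ 0]) (auto simp: GDERIV_const)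

lemma gradient_factors_add:
  assumes "gradient_factors A x f" "gradient_factors A x g"
  shows "gradient_factors A x (\<lambda>x. f x + g x)"
proof -
  obtain C where C: "eventually (\<lambda>n. \<bar>f (x n)\<bar> \<le> C \<and> (\<exists>y. norm y \<le> C \<and> GDERIV f (x n) :> A n *v y)) sequentially"
    using assms(1) unfolding gradient_factors_def by blast
  obtain D where D: "eventually (\<lambda>n. \<bar>g (x n)\<bar> \<le> D \<and> (\<exists>y. norm y \<le> D \<and> GDERIV g (x n) :> A n *v y)) sequentially"
    using assms(2) unfolding gradient_factors_def by blast
  show ?thesis
    unfolding gradient_factors_def
  proof (rule exI[of _ "C + D"], use C D in eventually_elim)
    case (elim n)
    then obtain y z where y: "norm y \<le> C" "GDERIV f (x n) :> A n *v y"
      and z: "norm z \<le> D" "GDERIV g (x n) :> A n *v z" by blast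
    have "GDERIV (\<lambda>x. f x + g x) (x n) :> A n *v (y + z)"
      using GDERIV_add[OF y(2) z(2)] by (simp add: matrix_vector_right_distrib)
    moreover have "norm (y + z) \<le> C + D" using y(1) z(1) norm_triangle_ineq[of y z] by linarith
    moreover have "\<bar>f (x n) + g (x n)\<bar> \<le> C + D" using elim by linarith
    ultimately show ?case by blast
  qed
qed

lemma gradient_factors_sum: "(\<And>i. i \<in> I \<Longrightarrow> gradient_factors A x (f i)) \<Longrightarrow> gradient_factors A x (\<lambda>x. \<Sum>i\<in>I. f i x)"
  by (induction I rule: infinite_finite_induct) (auto intro: gradient_factors_const gradient_factors_add)

lemma gradient_factors_mult:
  assumes "gradient_factors A x f" "gradient_factors A x g"
  shows "gradient_factors A x (\<lambda>x. f x * g x)"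
proof -
  obtain C where C: "eventually (\<lambda>n. \<bar>f (x n)\<bar> \<le> C \<and> (\<exists>y. norm y \<le> C \<and> GDERIV f (x n) :> A n *v y)) sequentially"
    using assms(1) unfolding gradient_factors_def by blast
  obtain D where D: "eventually (\<lambda>n. \<bar>g (x n)\<bar> \<le> D \<and> (\<exists>y. norm y \<le> D \<and> GDERIV g (x n) :> A n *v y)) sequentially"
    using assms(2) unfolding gradient_factors_def by blast
  show ?thesis
    unfolding gradient_factors_def
  proof (rule exI[of _ "C * D + D * C"], use C D in eventually_elim)
    case (elim n)
    then obtain y z where y: "norm y \<le> C" "GDERIV f (x n) :> A n *v y"
      and z: "norm z \<le> D" "GDERIV g (x n) :> A n *v z" by blast
    have "GDERIV (\<lambda>x. f x * g x) (x n) :> A n *v (f (x n) *\<^sub>R z + g (x n) *\<^sub>R y)"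
      using GDERIV_mult[OF y(2) z(2)] by (simp add: matrix_vector_right_distrib matrix_vector_mult_scaleR)
    moreover have "norm (f (x n) *\<^sub>R z + g (x n) *\<^sub>R y) \<le> C * D + D * C"
    proof (rule norm_triangle_le, rule add_mono)
      show "norm (f (x n) *\<^sub>R z) \<le> C * D" using elim z(1) by (auto intro!: mult_mono)
      show "norm (g (x n) *\<^sub>R y) \<le> D * C" using elim y(1) by (auto intro!: mult_mono)
    qed
    moreover have "\<bar>f (x n) * g (x n)\<bar> \<le> C * D + D * C"
    proof -
      have "\<bar>f (x n)\<bar> * \<bar>g (x n)\<bar> \<le> C * D" "0 \<le> D * C" using elim by (auto intro!: mult_mono)
      then show ?thesis unfolding abs_mult by linarith
    qed
    ultimately show ?case by blast
  qed
qed

text \<open>For states that are not reached: their mass \<open>f\<close> is at a minimum, which makes the gradient of the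
  product zero even if \<open>g\<close> involves a transition probability that is discontinuous there.\<close>

lemma gradient_factors_mult_vanishing:
  assumes f: "\<And>x. f differentiable (at x)" "\<And>x. 0 \<le> f x" "\<And>x. \<bar>g x\<bar> \<le> B"
    and zero: "eventually (\<lambda>n. f (x n) = 0) sequentially"
  shows "gradient_factors A x (\<lambda>x. f x * g x)"
  unfolding gradient_factors_def
proof (rule exI[of _ 0], use zero in eventually_elim)
  case (elim n)
  have "((\<lambda>x. f x * g x) has_derivative (\<lambda>_. 0)) (at (x n))"
    by (rule has_derivative_mult_vanishing[where B = B]) (use f elim in auto)
  then have "GDERIV (\<lambda>x. f x * g x) (x n) :> A n *v 0" by (simp add: gderiv_def)
  then show ?case using elim by (intro conjI exI[of _ 0]) auto
qed

lemma norm_axis: "norm (axis k c) = \<bar>c\<bar>" for c :: real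
  by (simp add: norm_eq_sqrt_inner inner_axis')

lemma pmfs_closed:
  assumes "\<And>n. X n \<in> pmfs" "X \<longlonglongrightarrow> L"
  shows "L \<in> pmfs"
  unfolding pmfs_def
proof (intro CollectI conjI allI)
  show "0 \<le> L $ i" for i
    using assms by (intro LIMSEQ_le_const[OF tendsto_vec_nth[OF assms(2)]]) (auto simp: pmfs_def)
  have "(\<lambda>n. \<Sum>i\<in>UNIV. X n $ i) \<longlonglongrightarrow> (\<Sum>i\<in>UNIV. L $ i)"
    by (intro tendsto_sum tendsto_vec_nth assms)
  moreover have "(\<lambda>n. \<Sum>i\<in>UNIV. X n $ i) = (\<lambda>_. 1)" using assms(1) by (auto simp: pmfs_def)
  ultimately show "(\<Sum>i\<in>UNIV. L $ i) = 1" by (simp add: LIMSEQ_const_iff)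
qed

text \<open>The limit \<open>L\<close> may lie on the boundary of the simplex, for example when the limiting dynamics are deterministic. What
  matters is that it still charges \<open>s\<close>.\<close>

lemma smooth_extension_tendsto:
  assumes f: "smooth_extension {\<mu> \<in> pmfs. \<mu> $ s > 0} f"
    and X: "\<And>n. X n \<in> pmfs" "X \<longlonglongrightarrow> L" "L \<in> pmfs" "L $ s > 0"
  obtains G where "(\<lambda>n. f (X n)) \<longlonglongrightarrow> f L" "(\<lambda>n. G (X n)) \<longlonglongrightarrow> G L"
    "\<And>\<mu>. \<mu> \<in> pmfs \<Longrightarrow> \<mu> $ s > 0 \<Longrightarrow>
      (f has_derivative (\<lambda>h. inner h (G \<mu>))) (at \<mu> within {\<mu> \<in> pmfs. \<mu> $ s > 0})"
proof -
  let ?D = "{\<mu> \<in> pmfs. \<mu> $ s > 0}"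
  obtain G where G: "continuous_on ?D G"
    and der: "\<And>\<mu>. \<mu> \<in> ?D \<Longrightarrow> (f has_derivative (\<lambda>h. inner h (G \<mu>))) (at \<mu> within ?D)"
    using smooth_extension_gradient[OF f convex_positive_pmfs] by blast
  have f: "continuous_on ?D f"
    unfolding continuous_on_eq_continuous_within using der has_derivative_continuous by blast
  have "eventually (\<lambda>n. X n $ s > 0) sequentially"
    using X(4) by (intro order_tendstoD(1)[OF tendsto_vec_nth[OF X(2)]])
  then have "eventually (\<lambda>n. X n \<in> ?D) sequentially" using X(1) by simp
  then show thesis
    using X by (intro that[of G] continuous_on_tendsto_compose[OF f] continuous_on_tendsto_compose[OF G] der) auto
qed

text \<open>By the chain rule the gradient of \<open>f \<circ> m\<close> is a combination of the gradients of the components of \<open>m\<close>,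
  with coefficients that converge along the sequence.\<close>

lemma gradient_factors_compose:
  fixes m :: "real ^ 'k \<Rightarrow> real ^ 's::finite"
  assumes m: "\<And>x. m x \<in> pmfs" and tm: "\<And>\<sigma>. gradient_factors A x (\<lambda>x. m x $ \<sigma>)"
    and lim: "(\<lambda>n. m (x n)) \<longlonglongrightarrow> L" "L \<in> pmfs" "L $ s > 0"
    and f: "smooth_extension {\<mu> \<in> pmfs. \<mu> $ s > 0} f"
  shows "gradient_factors A x (\<lambda>x. f (m x))"
proof -
  obtain G where flim: "(\<lambda>n. f (m (x n))) \<longlonglongrightarrow> f L" and Glim: "(\<lambda>n. G (m (x n))) \<longlonglongrightarrow> G L"
    and der: "\<And>\<mu>. \<mu> \<in> pmfs \<Longrightarrow> \<mu> $ s > 0 \<Longrightarrow>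
      (f has_derivative (\<lambda>h. inner h (G \<mu>))) (at \<mu> within {\<mu> \<in> pmfs. \<mu> $ s > 0})"
    using smooth_extension_tendsto[OF f, where X = "\<lambda>n. m (x n)"] m lim by blast
  have "\<exists>C. \<forall>\<sigma>. eventually (\<lambda>n. \<exists>y. norm y \<le> C \<sigma> \<and> GDERIV (\<lambda>x. m x $ \<sigma>) (x n) :> A n *v y) sequentially"
  proof (intro choice allI)
    fix \<sigma>
    from tm[of \<sigma>] show "\<exists>C. eventually (\<lambda>n. \<exists>y. norm y \<le> C \<and> GDERIV (\<lambda>x. m x $ \<sigma>) (x n) :> A n *v y) sequentially"
      unfolding gradient_factors_def by (blast intro: eventually_mono)
  qed
  then obtain C where "\<And>\<sigma>. eventually (\<lambda>n. \<exists>y. norm y \<le> C \<sigma> \<and>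
      GDERIV (\<lambda>x. m x $ \<sigma>) (x n) :> A n *v y) sequentially" by blast
  then have ev: "eventually (\<lambda>n. \<forall>\<sigma>. \<exists>y. norm y \<le> C \<sigma> \<and>
      GDERIV (\<lambda>x. m x $ \<sigma>) (x n) :> A n *v y) sequentially"
    by (rule eventually_all_finite)
  have evf: "eventually (\<lambda>n. \<bar>f (m (x n))\<bar> < \<bar>f L\<bar> + 1) sequentially"
    by (rule order_tendstoD(2)[OF tendsto_rabs[OF flim]]) simp
  have evG: "eventually (\<lambda>n. norm (G (m (x n))) < norm (G L) + 1) sequentially"
    by (rule order_tendstoD(2)[OF tendsto_norm[OF Glim]]) simp
  have evs: "eventually (\<lambda>n. m (x n) $ s > 0) sequentially"
    using lim(3) by (intro order_tendstoD(1)[OF tendsto_vec_nth[OF lim(1)]])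
  let ?K = "\<Sum>\<sigma>\<in>UNIV. (norm (G L) + 1) * C \<sigma>"
  show ?thesis
    unfolding gradient_factors_def
  proof (rule exI[of _ "(\<bar>f L\<bar> + 1) + ?K"], use ev evf evG evs in eventually_elim)
    case (elim n)
    then obtain y where y: "\<And>\<sigma>. norm (y \<sigma>) \<le> C \<sigma>" "\<And>\<sigma>. GDERIV (\<lambda>x. m x $ \<sigma>) (x n) :> A n *v y \<sigma>"
      by metis
    let ?G = "G (m (x n))" and ?y = "\<Sum>\<sigma>\<in>UNIV. G (m (x n)) $ \<sigma> *\<^sub>R y \<sigma>"
    have "GDERIV (\<lambda>x. f (m x)) (x n) :> (\<Sum>\<sigma>\<in>UNIV. ?G $ \<sigma> *\<^sub>R (A n *v y \<sigma>))"
      by (rule gderiv_smooth_compose[OF m elim(4) y(2) der[OF m elim(4)]])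
    then have "GDERIV (\<lambda>x. f (m x)) (x n) :> A n *v ?y"
      by (simp add: linear_sum[OF matrix_vector_mul_linear] matrix_vector_mult_scaleR)
    moreover have "norm ?y \<le> ?K"
    proof (rule order_trans[OF norm_sum], rule sum_mono)
      fix \<sigma>
      have "\<bar>?G $ \<sigma>\<bar> \<le> norm (G L) + 1" using component_le_norm_cart[of ?G \<sigma>] elim by linarith
      then show "norm (?G $ \<sigma> *\<^sub>R y \<sigma>) \<le> (norm (G L) + 1) * C \<sigma>"
        using y(1)[of \<sigma>] by (auto intro!: mult_mono)
    qed
    moreover have "0 \<le> ?K"
      using y(1) by (intro sum_nonneg mult_nonneg_nonneg) (auto intro: order_trans[OF norm_ge_zero])
    ultimately show ?case using elim by (intro conjI exI[of _ ?y]) auto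
  qed
qed

section \<open>Convergence to a pure policy\<close>

locale pure_limit =
  fixes M :: "('s::finite, 'a::finite) nmdp"
    and \<zeta> :: "'s \<Rightarrow> 'z::finite"
    and \<gamma> :: "nat \<Rightarrow> ('t::finite, 'z, 'a) param"
    and \<theta>_star :: "nat \<Rightarrow> 'z \<Rightarrow> real ^ 'a"
    and \<mu>_star :: "nat \<Rightarrow> real ^ 's"
  assumes mdp: "nonlinear_mdp M"
    and horizon: "horizon M = CARD('t)"
    and pure: "pure_policy (horizon M) \<theta>_star"
    and conv: "\<And>t z. t < horizon M \<Longrightarrow> (\<lambda>n. policy (\<gamma> n) t z) \<longlonglongrightarrow> \<theta>_star t z"
    and \<mu>_star: "\<And>t. t \<le> horizon M \<Longrightarrow> \<mu>_star t = lim (\<lambda>n. state_pmf M \<zeta> (\<gamma> n) t)"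
    and support: "\<And>t. t \<le> horizon M \<Longrightarrow>
      eventually (\<lambda>n. {s. state_pmf M \<zeta> (\<gamma> n) t $ s > 0} = {s. \<mu>_star t $ s > 0}) sequentially"
    and succ: "\<And>t. t < horizon M \<Longrightarrow>
      eventually (\<lambda>n. successors M t (state_pmf M \<zeta> (\<gamma> n) t) = successors M t (\<mu>_star t)) sequentially"
begin

abbreviation "A \<equiv> \<lambda>n. approx_fisher M \<zeta> (\<gamma> n)"

lemma state_pmf_in: "t \<le> horizon M \<Longrightarrow> state_pmf M \<zeta> g t \<in> pmfs"
  for g :: "('t, 'z, 'a) param"
  by (rule state_pmf_pmfs[OF mdp])

lemma smooth_transition:
  "t < horizon M \<Longrightarrow> smooth_extension {\<mu> \<in> pmfs. \<mu> $ s > 0} (\<lambda>\<mu>. transition M t \<mu> s a $ s')"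
  using mdp by (simp add: nonlinear_mdp_def)

lemma eventually_vanishing:
  assumes "t \<le> horizon M" "\<not> \<mu>_star t $ s > 0"
  shows "eventually (\<lambda>n. state_pmf M \<zeta> (\<gamma> n) t $ s = 0) sequentially"
  using support[OF assms(1)]
proof eventually_elim
  case (elim n)
  then have "\<not> state_pmf M \<zeta> (\<gamma> n) t $ s > 0" using assms(2) by blast
  then show ?case using pmfs_ge_0[OF state_pmf_in[OF assms(1)], of "\<gamma> n" s] by linarith
qed

text \<open>Convergence is proved forward in time. A state without mass in the limit has no mass eventually, so
  the possibly discontinuous transition probabilities out of it do not enter.\<close>

lemma state_pmf_tendsto: "t \<le> horizon M \<Longrightarrow> (\<lambda>n. state_pmf M \<zeta> (\<gamma> n) t) \<longlonglongrightarrow> \<mu>_star t"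
proof (induction t)
  case 0
  have "(\<lambda>n. state_pmf M \<zeta> (\<gamma> n) 0) \<longlonglongrightarrow> init_pmf M" by simp
  then show ?case using \<mu>_star[of 0] limI by force
next
  case (Suc t)
  then have t: "t < horizon M" and IH: "(\<lambda>n. state_pmf M \<zeta> (\<gamma> n) t) \<longlonglongrightarrow> \<mu>_star t" by auto
  have "\<exists>L. (\<lambda>n. state_pmf M \<zeta> (\<gamma> n) t $ s * policy (\<gamma> n) t (\<zeta> s) $ a *
      transition M t (state_pmf M \<zeta> (\<gamma> n) t) s a $ s') \<longlonglongrightarrow> L" for s a s'
  proof (cases "\<mu>_star t $ s > 0")
    case True
    have "(\<lambda>n. transition M t (state_pmf M \<zeta> (\<gamma> n) t) s a $ s') \<longlonglongrightarrow> transition M t (\<mu>_star t) s a $ s'"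
      by (rule smooth_extension_tendsto[OF smooth_transition[OF t, of s a s'], of "\<lambda>n. state_pmf M \<zeta> (\<gamma> n) t" "\<mu>_star t"])
        (use t IH True pmfs_closed[OF _ IH] state_pmf_in in auto)
    from tendsto_mult[OF tendsto_mult[OF tendsto_vec_nth[OF IH] tendsto_vec_nth[OF conv[OF t]]] this]
    show ?thesis by blast
  next
    case False
    show ?thesis
    proof (rule exI[of _ 0], rule tendsto_eventually)
      show "\<forall>\<^sub>F n in sequentially. state_pmf M \<zeta> (\<gamma> n) t $ s * policy (\<gamma> n) t (\<zeta> s) $ a *
          transition M t (state_pmf M \<zeta> (\<gamma> n) t) s a $ s' = 0"
        using eventually_vanishing[OF less_imp_le[OF t] False] by eventually_elim simp
    qed
  qed
  note term_converges = this
  define L where "L s a s' = lim (\<lambda>n. state_pmf M \<zeta> (\<gamma> n) t $ s * policy (\<gamma> n) t (\<zeta> s) $ a *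
      transition M t (state_pmf M \<zeta> (\<gamma> n) t) s a $ s')" for s a s'
  have L: "(\<lambda>n. state_pmf M \<zeta> (\<gamma> n) t $ s * policy (\<gamma> n) t (\<zeta> s) $ a *
      transition M t (state_pmf M \<zeta> (\<gamma> n) t) s a $ s') \<longlonglongrightarrow> L s a s'" for s a s'
  proof -
    obtain l where "(\<lambda>n. state_pmf M \<zeta> (\<gamma> n) t $ s * policy (\<gamma> n) t (\<zeta> s) $ a *
        transition M t (state_pmf M \<zeta> (\<gamma> n) t) s a $ s') \<longlonglongrightarrow> l"
      using term_converges by blast
    then show ?thesis unfolding L_def by (simp only: limI)
  qed
  have lim: "(\<lambda>n. state_pmf M \<zeta> (\<gamma> n) (Suc t)) \<longlonglongrightarrow> (\<chi> s'. \<Sum>s\<in>UNIV. \<Sum>a\<in>UNIV. L s a s')"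
    unfolding state_pmf.simps by (intro tendsto_vec_lambda tendsto_sum L)
  then show ?case unfolding \<mu>_star[OF Suc.prems] limI[OF lim] .
qed

lemma \<mu>_star_pmfs: "t \<le> horizon M \<Longrightarrow> \<mu>_star t \<in> pmfs"
  by (rule pmfs_closed[OF _ state_pmf_tendsto]) (auto intro: state_pmf_in)

lemma block_mass_tendsto:
  "t \<le> horizon M \<Longrightarrow> (\<lambda>n. block_mass \<zeta> (state_pmf M \<zeta> (\<gamma> n) t) z) \<longlonglongrightarrow> block_mass \<zeta> (\<mu>_star t) z"
  unfolding block_mass_def by (intro tendsto_sum tendsto_vec_nth state_pmf_tendsto)

text \<open>The mass of the block of \<open>s\<close> converges to a positive limit, so dividing by it is harmless.\<close>

lemma gradient_factors_policy:
  assumes t: "t < horizon M" and s: "\<mu>_star t $ s > 0"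
  shows "gradient_factors A \<gamma> (\<lambda>\<gamma>. policy \<gamma> t (\<zeta> s) $ a)"
proof -
  let ?b = "block_mass \<zeta> (\<mu>_star t) (\<zeta> s)" and ?m = "\<lambda>n. block_mass \<zeta> (state_pmf M \<zeta> (\<gamma> n) t) (\<zeta> s)"
  have "\<mu>_star t $ s \<le> ?b"
    unfolding block_mass_def using pmfs_ge_0[OF \<mu>_star_pmfs] t by (intro member_le_sum) auto
  then have b: "?b > 0" using s by linarith
  then have "eventually (\<lambda>n. ?m n > ?b / 2) sequentially"
    using t by (intro order_tendstoD(1)[OF block_mass_tendsto]) auto
  then show ?thesis
    unfolding gradient_factors_def
  proof (intro exI[of _ "1 + 2 / ?b"], eventually_elim)
    case (elim n)
    let ?y = "axis (from_nat_into UNIV t, \<zeta> s, a) (1 / ?m n)"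
    have m: "?m n > 0" using elim b by linarith
    have "1 / ?m n \<le> 2 / ?b" using elim b m by (simp add: field_simps)
    then have "norm ?y \<le> 1 + 2 / ?b" using m b by (simp add: norm_axis)
    moreover have "GDERIV (\<lambda>\<gamma>. policy \<gamma> t (\<zeta> s) $ a) (\<gamma> n) :> A n *v ?y"
      using gderiv_policy[of t "\<zeta> s" a "\<gamma> n"] approx_fisher_policy_score[of t \<zeta> M "\<gamma> n" "\<zeta> s" a] t m
      by (simp add: horizon)
    moreover have "\<bar>policy (\<gamma> n) t (\<zeta> s) $ a\<bar> \<le> 1 + 2 / ?b"
    proof -
      have "0 \<le> 2 / ?b" using b by simp
      then show ?thesis
        using pmfs_le_1[OF policy_pmfs[of "\<gamma> n" t "\<zeta> s"], of a] policy_pos[of "\<gamma> n" t "\<zeta> s" a] by linarith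
    qed
    ultimately show ?case by blast
  qed
qed

lemma gradient_factors_compose_state_pmf:
  assumes t: "t \<le> horizon M" and s: "\<mu>_star t $ s > 0"
    and m: "\<And>s. gradient_factors A \<gamma> (\<lambda>\<gamma>. state_pmf M \<zeta> \<gamma> t $ s)"
    and f: "smooth_extension {\<mu> \<in> pmfs. \<mu> $ s > 0} f"
  shows "gradient_factors A \<gamma> (\<lambda>\<gamma>. f (state_pmf M \<zeta> \<gamma> t))"
  by (rule gradient_factors_compose[OF state_pmf_in[OF t] m state_pmf_tendsto[OF t] \<mu>_star_pmfs[OF t] s f])

text \<open>The recursion for the state masses is built from sums and products, apart from the states without
  mass in the limit. These have mass zero along the sequence as well, so they contribute gradient zero:
  the mass is at a minimum and the transition probabilities are bounded.\<close>

lemma gradient_factors_state_pmf: "t \<le> horizon M \<Longrightarrow> gradient_factors A \<gamma> (\<lambda>\<gamma>. state_pmf M \<zeta> \<gamma> t $ s)"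
proof (induction t arbitrary: s)
  case 0
  then show ?case by (simp add: gradient_factors_const)
next
  case (Suc t s')
  then have t: "t < horizon M" by simp
  note IH = Suc.IH[OF less_imp_le[OF t]]
  have "gradient_factors A \<gamma> (\<lambda>\<gamma>. state_pmf M \<zeta> \<gamma> t $ s * (policy \<gamma> t (\<zeta> s) $ a *
      transition M t (state_pmf M \<zeta> \<gamma> t) s a $ s'))" for s a
  proof (cases "\<mu>_star t $ s > 0")
    case True
    then show ?thesis
      by (intro gradient_factors_mult gradient_factors_policy t IH
          gradient_factors_compose_state_pmf[OF less_imp_le[OF t] True IH smooth_transition[OF t]])
  next
    case False
    show ?thesis
    proof (rule gradient_factors_mult_vanishing[where B = 1])
      fix g :: "('t, 'z, 'a) param"
      have tr: "transition M t (state_pmf M \<zeta> g t) s a \<in> pmfs" by (rule transition_pmfs[OF mdp t])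
      have pol: "policy g t (\<zeta> s) \<in> pmfs" by (rule policy_pmfs)
      show "\<bar>policy g t (\<zeta> s) $ a * transition M t (state_pmf M \<zeta> g t) s a $ s'\<bar> \<le> 1"
        using pmfs_ge_0[OF tr] pmfs_le_1[OF tr] pmfs_ge_0[OF pol] pmfs_le_1[OF pol]
        by (simp add: abs_mult mult_le_one)
      show "(\<lambda>\<gamma>. state_pmf M \<zeta> \<gamma> t $ s) differentiable at g"
        using t by (intro state_pmf_differentiable[OF mdp]) simp
      show "0 \<le> state_pmf M \<zeta> g t $ s" using t by (intro pmfs_ge_0 state_pmf_in) simp
    qed (use eventually_vanishing[OF less_imp_le[OF t] False] in simp)
  qed
  then show ?case by (auto simp: mult.assoc intro!: gradient_factors_sum)
qed

lemma gradient_factors_objective: "gradient_factors A \<gamma> (objective_over (\<lambda>t. {s. \<mu>_star t $ s > 0}) M \<zeta>)"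
proof -
  have r: "smooth_extension {\<mu> \<in> pmfs. \<mu> $ s > 0} (\<lambda>\<mu>. reward M t \<mu> s a)" if "t < horizon M" for t s a
    using mdp that by (simp add: nonlinear_mdp_def)
  have f: "smooth_extension {\<mu> \<in> pmfs. \<mu> $ s > 0} (\<lambda>\<mu>. final_reward M \<mu> s)" for s
    using mdp by (simp add: nonlinear_mdp_def)
  show ?thesis
    unfolding objective_over_def
    by (intro gradient_factors_add gradient_factors_sum gradient_factors_mult gradient_factors_state_pmf gradient_factors_policy
        gradient_factors_compose_state_pmf[OF _ _ gradient_factors_state_pmf r] gradient_factors_compose_state_pmf[OF _ _ gradient_factors_state_pmf f]) auto
qed

text \<open>The set of visited states over which the objective is summed is eventually the support of the limit,
  so from then on \<open>objective_gradient\<close> is the gradient of one fixed function.\<close>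

lemma objective_gradient_factor:
  "\<exists>C. eventually (\<lambda>n. \<exists>h. norm h \<le> C \<and> objective_gradient M \<zeta> (\<gamma> n) = A n *v h) sequentially"
proof -
  let ?S = "\<lambda>t. {s. \<mu>_star t $ s > 0}"
  have "eventually (\<lambda>n. \<forall>t\<in>{..horizon M}. visited M \<zeta> (\<gamma> n) t = ?S t) sequentially"
    unfolding visited_def using support by (intro eventually_ball_finite) auto
  moreover obtain C where "eventually (\<lambda>n. \<bar>objective_over ?S M \<zeta> (\<gamma> n)\<bar> \<le> C \<and>
      (\<exists>y. norm y \<le> C \<and> GDERIV (objective_over ?S M \<zeta>) (\<gamma> n) :> A n *v y)) sequentially"
    using gradient_factors_objective unfolding gradient_factors_def by blast
  ultimately have "eventually (\<lambda>n. \<exists>h. norm h \<le> C \<and> objective_gradient M \<zeta> (\<gamma> n) = A n *v h) sequentially"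
  proof eventually_elim
    case (elim n)
    have "objective_over (visited M \<zeta> (\<gamma> n)) M \<zeta> = (objective_over ?S M \<zeta> :: ('t, 'z, 'a) param \<Rightarrow> real)"
      unfolding objective_over_def using elim(1) by (intro ext) simp
    then show ?case using elim(2) unfolding objective_gradient_def by (metis gradient_eqI)
  qed
  then show ?thesis by blast
qed

text \<open>A transition that is possible in the limit has probability bounded below along the sequence, which
  bounds the gradient of its logarithm. Any other transition is eventually impossible or leaves a state without
  mass, and its score is zero by definition.\<close>

lemma transition_score_factor:
  assumes t: "t < horizon M"
  shows "\<exists>C. eventually (\<lambda>n. \<exists>y. norm y \<le> C \<and> transition_score M \<zeta> (\<gamma> n) t s a s' = A n *v y) sequentially"
proof (cases "(s, a, s') \<in> successors M t (\<mu>_star t)")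
  case True
  let ?p = "\<lambda>\<gamma> :: ('t, 'z, 'a) param. transition M t (state_pmf M \<zeta> \<gamma> t) s a $ s'"
  let ?q = "transition M t (\<mu>_star t) s a $ s'"
  have s: "\<mu>_star t $ s > 0" and q: "?q > 0" using True by (auto simp: successors_def)
  have t': "t \<le> horizon M" using t by simp
  have "gradient_factors A \<gamma> ?p"
    by (rule gradient_factors_compose_state_pmf[OF t' s gradient_factors_state_pmf[OF t'] smooth_transition[OF t]])
  then obtain C where C: "eventually (\<lambda>n. \<bar>?p (\<gamma> n)\<bar> \<le> C \<and>
      (\<exists>y. norm y \<le> C \<and> GDERIV ?p (\<gamma> n) :> A n *v y)) sequentially"
    unfolding gradient_factors_def by blast
  have "(\<lambda>n. ?p (\<gamma> n)) \<longlonglongrightarrow> ?q"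
    by (rule smooth_extension_tendsto[OF smooth_transition[OF t, of s a s'], of "\<lambda>n. state_pmf M \<zeta> (\<gamma> n) t" "\<mu>_star t"])
      (use t' s state_pmf_tendsto \<mu>_star_pmfs state_pmf_in in auto)
  then have "eventually (\<lambda>n. ?p (\<gamma> n) > ?q / 2) sequentially"
    by (rule order_tendstoD) (use q in simp)
  with C support[OF t']
  have "eventually (\<lambda>n. \<exists>y. norm y \<le> 2 / ?q * C \<and> transition_score M \<zeta> (\<gamma> n) t s a s' = A n *v y) sequentially"
  proof eventually_elim
    case (elim n)
    then obtain y where y: "norm y \<le> C" "GDERIV ?p (\<gamma> n) :> A n *v y" by blast
    have p: "?p (\<gamma> n) > 0" "1 / ?p (\<gamma> n) \<le> 2 / ?q" using elim(3) q by (auto simp: field_simps)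
    have "state_pmf M \<zeta> (\<gamma> n) t $ s > 0" using elim(2) s by blast
    from gderiv_transition[OF mdp t this, of a s'] y(2)
    have "?p (\<gamma> n) *\<^sub>R transition_score M \<zeta> (\<gamma> n) t s a s' = A n *v y"
      using gradient_eqI by metis
    then have "A n *v ((1 / ?p (\<gamma> n)) *\<^sub>R y) =
        (1 / ?p (\<gamma> n)) *\<^sub>R ?p (\<gamma> n) *\<^sub>R transition_score M \<zeta> (\<gamma> n) t s a s'"
      by (simp add: matrix_vector_mult_scaleR)
    then have "transition_score M \<zeta> (\<gamma> n) t s a s' = A n *v ((1 / ?p (\<gamma> n)) *\<^sub>R y)" using p by simp
    moreover have "norm ((1 / ?p (\<gamma> n)) *\<^sub>R y) \<le> 2 / ?q * C"
      using mult_mono[OF p(2) y(1)] p q by simp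
    ultimately show ?case by blast
  qed
  then show ?thesis by blast
next
  case False
  have "eventually (\<lambda>n. \<exists>y. norm y \<le> 0 \<and> transition_score M \<zeta> (\<gamma> n) t s a s' = A n *v y) sequentially"
    using succ[OF t]
  proof eventually_elim
    case (elim n)
    then have "(s, a, s') \<notin> successors M t (state_pmf M \<zeta> (\<gamma> n) t)" using False by simp
    then have "transition_score M \<zeta> (\<gamma> n) t s a s' = 0" by (auto simp: successors_def transition_score_def)
    then show ?case by (intro exI[of _ 0]) simp
  qed
  then show ?thesis by blast
qed

text \<open>The entries of \<open>diag p - p p\<^sup>T\<close> are continuous in \<open>p\<close> and vanish at the vertices of the simplex.\<close>

lemma approx_fisher_tendsto_0: "A \<longlonglongrightarrow> 0"
proof (intro vec_tendstoI)
  fix k l :: "'t \<times> 'z \<times> 'a"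
  obtain i z b i' z' b' where kl: "k = (i, z, b)" "l = (i', z', b')" by (metis prod_cases3)
  let ?t = "to_nat_on UNIV i"
  have t: "?t < horizon M" by (simp add: horizon to_nat_on_UNIV)
  have \<theta>: "\<theta>_star ?t z \<in> pmfs" "is_singleton {a. \<theta>_star ?t z $ a > 0}"
    using pure t by (auto simp: pure_policy_def)
  then obtain a0 where a0: "{a. \<theta>_star ?t z $ a > 0} = {a0}" by (auto simp: is_singleton_def)
  have zero: "\<theta>_star ?t z $ a = 0" if "a \<noteq> a0" for a
    using a0 that pmfs_ge_0[OF \<theta>(1), of a] by (metis (mono_tags) mem_Collect_eq order_le_less singletonD)
  have "(\<Sum>a\<in>UNIV. \<theta>_star ?t z $ a) = \<theta>_star ?t z $ a0"
    using sum.mono_neutral_right[of UNIV "{a0}" "\<lambda>a. \<theta>_star ?t z $ a"] zero by simp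
  then have one: "\<theta>_star ?t z $ a0 = 1" using \<theta>(1) by (simp add: pmfs_def)
  have lim: "(\<lambda>n. block_mass \<zeta> (state_pmf M \<zeta> (\<gamma> n) ?t) z * (policy (\<gamma> n) ?t z $ b *
      ((if b = b' then 1 else 0) - policy (\<gamma> n) ?t z $ b'))) \<longlonglongrightarrow>
    block_mass \<zeta> (\<mu>_star ?t) z * (\<theta>_star ?t z $ b * ((if b = b' then 1 else 0) - \<theta>_star ?t z $ b'))"
    using t by (intro tendsto_intros block_mass_tendsto tendsto_vec_nth conv) auto
  have "\<theta>_star ?t z $ b * ((if b = b' then 1 else 0) - \<theta>_star ?t z $ b') = 0"
    using zero one by (cases "b = a0"; cases "b' = a0") auto
  with lim have "(\<lambda>n. block_mass \<zeta> (state_pmf M \<zeta> (\<gamma> n) ?t) z * (policy (\<gamma> n) ?t z $ b *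
      ((if b = b' then 1 else 0) - policy (\<gamma> n) ?t z $ b'))) \<longlonglongrightarrow> 0" by simp
  then show "(\<lambda>n. A n $ k $ l) \<longlonglongrightarrow> 0 $ k $ l"
    by (cases "i = i' \<and> z = z'") (auto simp: kl approx_fisher_def softmax_fisher_eq policy_def)
qed

lemma fisher_factor:
  "\<exists>K. eventually (\<lambda>n. \<exists>Y. transpose Y = Y \<and> fisher M \<zeta> (\<gamma> n) = A n + A n ** Y ** A n \<and>
     (\<forall>v. norm (Y *v v) \<le> K * norm v)) sequentially"
proof -
  let ?I = "{..<horizon M} \<times> (UNIV :: 's set) \<times> (UNIV :: 'a set) \<times> (UNIV :: 's set)"
  define w where "w n = (\<lambda>(t, s, a, s'). transition_score M \<zeta> (\<gamma> n) t s a s')" for n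
  define c where "c n = (\<lambda>(t, s, a, s'). state_pmf M \<zeta> (\<gamma> n) t $ s * policy (\<gamma> n) t (\<zeta> s) $ a *
    transition M t (state_pmf M \<zeta> (\<gamma> n) t) s a $ s')" for n
  have "\<forall>i\<in>?I. \<exists>C. eventually (\<lambda>n. \<exists>y. norm y \<le> C \<and> w n i = A n *v y) sequentially"
    using transition_score_factor by (auto simp: w_def)
  from bchoice[OF this] obtain C
    where "\<forall>i\<in>?I. eventually (\<lambda>n. \<exists>y. norm y \<le> C i \<and> w n i = A n *v y) sequentially" ..
  then have "eventually (\<lambda>n. \<forall>i\<in>?I. \<exists>y. norm y \<le> C i \<and> w n i = A n *v y) sequentially"
    by (intro eventually_ball_finite) auto
  then have "eventually (\<lambda>n. \<exists>Y. transpose Y = Y \<and> fisher M \<zeta> (\<gamma> n) = A n + A n ** Y ** A n \<and>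
     (\<forall>v. norm (Y *v v) \<le> (\<Sum>i\<in>?I. (C i)\<^sup>2) * norm v)) sequentially"
  proof eventually_elim
    case (elim n)
    from bchoice[OF this] obtain y where "\<forall>i\<in>?I. norm (y i) \<le> C i \<and> w n i = A n *v y i" ..
    then have y: "norm (y i) \<le> C i" "w n i = A n *v y i" if "i \<in> ?I" for i
      using that by blast+
    have c: "0 \<le> c n i \<and> c n i \<le> 1" if "i \<in> ?I" for i
    proof -
      obtain t s a s' where i: "i = (t, s, a, s')" by (rule prod_cases4)
      have t: "t < horizon M" using that i by simp
      have m: "state_pmf M \<zeta> (\<gamma> n) t \<in> pmfs" using t by (intro state_pmf_in) simp
      have p: "transition M t (state_pmf M \<zeta> (\<gamma> n) t) s a \<in> pmfs" by (rule transition_pmfs[OF mdp t])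
      have pol: "policy (\<gamma> n) t (\<zeta> s) \<in> pmfs" by (rule policy_pmfs)
      show ?thesis
        unfolding c_def i case_prod_conv
        by (intro conjI mult_nonneg_nonneg mult_le_one pmfs_ge_0 pmfs_le_1 m p pol)
    qed
    define Y where "Y = (\<Sum>i\<in>?I. c n i *\<^sub>R outer (y i) (y i))"
    have "transpose Y = Y"
      by (simp add: Y_def vec_eq_iff transpose_def outer_def sum_component mult.commute)
    moreover have "norm (Y *v v) \<le> (\<Sum>i\<in>?I. (C i)\<^sup>2) * norm v" for v
      unfolding Y_def by (rule norm_sum_outer_mult_le[OF c y(1)])
    moreover have "fisher M \<zeta> (\<gamma> n) = A n + A n ** Y ** A n"
    proof -
      have "A n ** Y ** A n = (\<Sum>i\<in>?I. c n i *\<^sub>R outer (w n i) (w n i))"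
        unfolding Y_def sum_outer_congruence[OF transpose_approx_fisher, symmetric]
        by (intro sum.cong refl) (simp only: y(2))
      then have "(A n ** Y ** A n) $ k $ l = (\<Sum>i\<in>?I. c n i * (w n i $ k * w n i $ l))" for k l
        by (simp add: sum_component outer_def)
      also have "(\<Sum>i\<in>?I. c n i * (w n i $ k * w n i $ l)) =
          fisher M \<zeta> (\<gamma> n) $ k $ l - A n $ k $ l" for k l
        unfolding fisher_nth[OF mdp horizon] sum.cartesian_product add_diff_cancel_left'
        by (intro sum.cong refl) (auto simp: c_def w_def)
      finally show ?thesis by (simp add: vec_eq_iff)
    qed
    ultimately show ?case by blast
  qed
  then show ?thesis by blast
qed

lemma natural_gradient_diff_tendsto_0:
  "(\<lambda>n. norm (natural_gradient M \<zeta> (\<gamma> n) - approx_natural_gradient M \<zeta> (\<gamma> n))) \<longlonglongrightarrow> 0"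
proof -
  obtain K0 where K0: "eventually (\<lambda>n. \<exists>Y. transpose Y = Y \<and> fisher M \<zeta> (\<gamma> n) = A n + A n ** Y ** A n \<and>
     (\<forall>v. norm (Y *v v) \<le> K0 * norm v)) sequentially" using fisher_factor by blast
  define K where "K = \<bar>K0\<bar>"
  obtain C where C: "eventually (\<lambda>n. \<exists>h. norm h \<le> C \<and> objective_gradient M \<zeta> (\<gamma> n) = A n *v h) sequentially"
    using objective_gradient_factor by blast
  define \<epsilon> where "\<epsilon> n = K * (\<Sum>k\<in>UNIV. \<Sum>l\<in>UNIV. \<bar>A n $ k $ l\<bar>)" for n
  have "\<epsilon> \<longlonglongrightarrow> K * (\<Sum>k\<in>UNIV. \<Sum>l\<in>UNIV. \<bar>(0 :: real ^ ('t \<times> 'z \<times> 'a) ^ ('t \<times> 'z \<times> 'a)) $ k $ l\<bar>)"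
    unfolding \<epsilon>_def by (intro tendsto_intros tendsto_vec_nth approx_fisher_tendsto_0)
  then have \<epsilon>0: "\<epsilon> \<longlonglongrightarrow> 0" by simp
  have "eventually (\<lambda>n. \<epsilon> n < 1 / 2) sequentially" by (rule order_tendstoD(2)[OF \<epsilon>0]) simp
  with K0 C have "eventually (\<lambda>n. norm (norm (natural_gradient M \<zeta> (\<gamma> n) - approx_natural_gradient M \<zeta> (\<gamma> n)))
      \<le> 2 * \<epsilon> n * C) sequentially"
  proof eventually_elim
    case (elim n)
    then obtain Y h where Y: "transpose Y = Y" "fisher M \<zeta> (\<gamma> n) = A n + A n ** Y ** A n"
        "\<And>v. norm (Y *v v) \<le> K0 * norm v"
      and h: "norm h \<le> C" "objective_gradient M \<zeta> (\<gamma> n) = A n *v h" by blast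
    have "norm ((Y ** A n) *v v) \<le> \<epsilon> n * norm v" for v
    proof -
      have "norm (Y *v (A n *v v)) \<le> K * norm (A n *v v)"
        using Y(3)[of "A n *v v"] mult_right_mono[OF abs_ge_self[of K0] norm_ge_zero[of "A n *v v"]]
        unfolding K_def by linarith
      also have "\<dots> \<le> K * ((\<Sum>k\<in>UNIV. \<Sum>l\<in>UNIV. \<bar>A n $ k $ l\<bar>) * norm v)"
      proof (rule mult_left_mono)
        have "norm (A n *v v) \<le> onorm ((*v) (A n)) * norm v"
          by (rule onorm) (rule matrix_vector_mul_bounded_linear)
        also have "\<dots> \<le> (\<Sum>k\<in>UNIV. \<Sum>l\<in>UNIV. \<bar>A n $ k $ l\<bar>) * norm v"
          by (intro mult_right_mono onorm_le_matrix_component_sum) simp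
        finally show "norm (A n *v v) \<le> (\<Sum>k\<in>UNIV. \<Sum>l\<in>UNIV. \<bar>A n $ k $ l\<bar>) * norm v" .
      qed (simp add: K_def)
      finally show ?thesis by (simp add: \<epsilon>_def matrix_vector_mul_assoc mult.assoc)
    qed
    then have "norm (natural_gradient M \<zeta> (\<gamma> n) - approx_natural_gradient M \<zeta> (\<gamma> n)) \<le> 2 * \<epsilon> n * norm h"
      unfolding natural_gradient_def approx_natural_gradient_def Y(2) h(2)
      using elim(3) by (intro pinv_perturbation[OF transpose_approx_fisher Y(1)]) auto
    also have "\<dots> \<le> 2 * \<epsilon> n * C"
      using h(1) by (intro mult_left_mono) (auto simp: \<epsilon>_def K_def intro!: mult_nonneg_nonneg sum_nonneg)
    finally show ?case by simp
  qed
  moreover have "(\<lambda>n. 2 * \<epsilon> n * C) \<longlonglongrightarrow> 0"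
    using tendsto_mult[OF tendsto_mult[OF tendsto_const \<epsilon>0] tendsto_const, of 2 C] by simp
  ultimately show ?thesis by (rule Lim_null_comparison)
qed

end

theorem theorem5:
  fixes M :: "('s::finite, 'a::finite) nmdp"
    and \<zeta> :: "'s \<Rightarrow> 'z::finite"
    and \<gamma> :: "nat \<Rightarrow> ('t::finite, 'z, 'a) param"
    and \<theta>_star :: "nat \<Rightarrow> 'z \<Rightarrow> real ^ 'a"
    and \<mu>_star :: "nat \<Rightarrow> real ^ 's"
    and \<U> :: "(nat \<times> 'z) set"
    and N :: "('t, 'z, 'a) param set"
  assumes mdp: "nonlinear_mdp M"
    and horizon: "horizon M = CARD('t)"
    and pure: "pure_policy (horizon M) \<theta>_star"
    and centered: "\<And>n. \<gamma> n \<in> centered_params"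
    and conv: "\<And>t z. t < horizon M \<Longrightarrow> (\<lambda>n. policy (\<gamma> n) t z) \<longlonglongrightarrow> \<theta>_star t z"
    and \<mu>_star: "\<And>t. t \<le> horizon M \<Longrightarrow> \<mu>_star t = lim (\<lambda>n. state_pmf M \<zeta> (\<gamma> n) t)"
    and unvisited: "eventually (\<lambda>n. unvisited M \<zeta> (\<gamma> n) = \<U>) sequentially"
    and null_space: "eventually (\<lambda>n. {v. fisher M \<zeta> (\<gamma> n) *v v = 0} = N) sequentially"
    and dim_null_space: "dim N = horizon M * CARD('z) + (CARD('a) - 1) * card \<U>"
    and support: "\<And>t. t \<le> horizon M \<Longrightarrow>
      eventually (\<lambda>n. {s. state_pmf M \<zeta> (\<gamma> n) t $ s > 0} = {s. \<mu>_star t $ s > 0}) sequentially"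
    and succ: "\<And>t. t < horizon M \<Longrightarrow>
      eventually (\<lambda>n. successors M t (state_pmf M \<zeta> (\<gamma> n) t) = successors M t (\<mu>_star t)) sequentially"
  shows "(\<lambda>n. norm (natural_gradient M \<zeta> (\<gamma> n) - approx_natural_gradient M \<zeta> (\<gamma> n)))
           \<longlonglongrightarrow> 0"
proof -
  interpret limit: pure_limit M \<zeta> \<gamma> \<theta>_star \<mu>_star
    by unfold_locales (fact mdp horizon pure conv \<mu>_star support succ)+
  show ?thesis by (rule limit.natural_gradient_diff_tendsto_0)
qed

end
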